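(* Let $(V,(\cdot,\cdot)_V)$ and $(H,(\cdot,\cdot)_H)$ be separable real Hilbert spaces such that $V$ is densely and continuously embedded into $H$ with embedding constant $c_{VH}>0$, giving the Gelfand triple $V\subset H\subset V^*$. Suppose that $l_V,l_H\in\mathbb{R}$ satisfy $l_V<0$ and $l_H<-l_V/c_{VH}^2$, and let $\|\cdot\|_W$ be the norm on $V$ induced by the scalar product $(x_1,x_2)_W=-l_V(x_1,x_2)_V-l_H(x_1,x_2)_H$. Let $\tilde x\in V$, $\bar y\in V^*$ and $R>0$. Let $$F_V:B_W(\tilde x,R)\subset V\to\mathcal{CBC}(V^* )\quad\text{and}\quad F_H:B_W(\tilde x,R)\subset V\to\mathcal{CBC}(H)$$ be bounded and compactly upper hemicontinuous (c-uhc), and let $F:B_W(\tilde x,R)\rightrightarrows V^*$ be given by $F=F_V+F_H$, i.e. $$F(v)=\{y_V+y_H:\ y_V\in F_V(v),\ y_H\in F_H(v)\}\quad\text{for } v\in B_W(\tilde x,R).$$ Suppose furthermore that there exist $\tilde y_V\in F_V(\tilde x)$ and $\tilde y_H\in F_H(\tilde x)$ such that, with $\tilde y:=\tilde y_V+\tilde y_H$, $$\|\bar y-\tilde y\|_{W^*}\le R,$$ and such that for every $x\in B_W(\tilde x,R)$ there exist $y_V\in F_V(x)$ and $y_H\in F_H(x)$ with $$\langle y_V-\tilde y_V,x-\tilde x\rangle\le l_V\|x-\tilde x\|_V^2\quad\text{and}\quad (y_H-\tilde y_H,x-\tilde x)_H\le l_H\|x-\tilde x\|_H^2.$$ Finally,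 let $x_c:=\tilde x-\tfrac12 J_W(\bar y-\tilde y)$. Then there exists some $$\bar x\in B_W\bigl(x_c,\tfrac12\|\tilde y-\bar y\|_{W^*}\bigr)\quad\text{satisfying}\quad \bar y\in F(\bar x).$$
   Context: The embedding constant satisfies $\|v\|_H\le c_{VH}\|v\|_V$ for all $v\in V$. $H$ is identified with its dual $H^*$, so that $V\subset H\subset V^*$ (the second inclusion is the dual of the first), and the dual pairing $\langle\cdot,\cdot\rangle:V^*\times V\to\mathbb{R}$ satisfies $\langle y,x\rangle=(y,x)_H$ for $x\in V$, $y\in H$. The bilinear form $(\cdot,\cdot)_W$ is a scalar product on $V$ whose norm $\|\cdot\|_W$ is equivalent to $\|\cdot\|_V$. $B_W(x,R)=\{y\in V:\|y-x\|_W\le R\}$. For $y\in V^*$, $\|y\|_{W^*}=\sup_{x\in V\setminus\{0\}}\langle y,x\rangle/\|x\|_W$. $J_W:V^*\to V$ is the canonical isometric isomorphism given by $(J_W\phi,v)_W=\langle\phi,v\rangle$ for all $v\in V$, $\phi\in V^*$. $\mathcal{CBC}(X)$ is the set of all nonempty closed, bounded and convex subsets of a normed space $X$. A set-valued mapping is bounded if the union of its images is a bounded set (in $V^*$ for $F_V$, in $H$ for $F_H$). Compact upper hemicontinuity (c-uhc) on the weakly sequentially closed set $M=B_W(\tilde x,R)\subset V$: - $F_V:M\to\mathcal{CBC}(V^* )$ is c-uhc if for every sequence $(x_k)\subset M$ converging weakly in $V$ to some $x\in M$, $\limsup_{k\to\infty}\sup_{\phi\in F_V(x_k)}\langle\phi,v\rangle\le\sup_{\phi\in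 F_V(x)}\langle\phi,v\rangle$ for all $v\in V$. - $F_H:M\to\mathcal{CBC}(H)$ is c-uhc if for every sequence $(x_k)\subset M$ converging weakly in $V$ to some $x\in M$, $\limsup_{k\to\infty}\sup_{y\in F_H(x_k)}(y,v)_H\le\sup_{y\in F_H(x)}(y,v)_H$ for all $v\in H$. *)

theory Defs
  imports "HOL-Analysis.Analysis"
begin

text \<open>The dual space \<open>V\<^sup>*\<close> is the type of bounded linear functionals \<open>'v \<Rightarrow>\<^sub>L real\<close>, and the dual
  pairing is function application. The inclusion of \<open>V\<close> into \<open>H\<close> is an injective bounded linear
  map \<open>j\<close>.\<close>

definition gelfand_triple ::
    "('v::{real_inner,complete_space} \<Rightarrow>\<^sub>L 'h::{real_inner,complete_space}) \<Rightarrow> real \<Rightarrow> bool" where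
  "gelfand_triple j c \<longleftrightarrow>
     separable_space (euclidean :: 'v topology) \<and> separable_space (euclidean :: 'h topology) \<and>
     inj (blinfun_apply j) \<and> closure (range (blinfun_apply j)) = UNIV \<and>
     c > 0 \<and> (\<forall>v. norm (j v) \<le> c * norm v)"

text \<open>The inclusion of \<open>H\<close> (identified with its dual) into \<open>V\<^sup>*\<close>, dual to \<open>j\<close>:
  \<open>y\<close> is mapped to the functional \<open>\<lambda>v. j v \<bullet> y\<close>.\<close>

definition dual_embed ::
    "('v::real_inner \<Rightarrow>\<^sub>L 'h::real_inner) \<Rightarrow> 'h \<Rightarrow> ('v \<Rightarrow>\<^sub>L real)" where
  "dual_embed j y = blinfun_inner_left y o\<^sub>L j"

definition W_inner ::
    "('v::real_inner \<Rightarrow>\<^sub>L 'h::real_inner) \<Rightarrow> real \<Rightarrow> real \<Rightarrow> 'v \<Rightarrow> 'v \<Rightarrow> real" where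
  "W_inner j lV lH x y = - lV * (x \<bullet> y) - lH * (j x \<bullet> j y)"

definition W_norm ::
    "('v::real_inner \<Rightarrow>\<^sub>L 'h::real_inner) \<Rightarrow> real \<Rightarrow> real \<Rightarrow> 'v \<Rightarrow> real" where
  "W_norm j lV lH x = sqrt (W_inner j lV lH x x)"

definition W_cball ::
    "('v::real_inner \<Rightarrow>\<^sub>L 'h::real_inner) \<Rightarrow> real \<Rightarrow> real \<Rightarrow> 'v \<Rightarrow> real \<Rightarrow> 'v set" where
  "W_cball j lV lH x r = {y. W_norm j lV lH (y - x) \<le> r}"

text \<open>The element 0 only serves to give the supremum the value 0 if \<open>V = {0}\<close>. Otherwise it is
  without effect, since the quotients at \<open>x\<close> and \<open>- x\<close> have opposite signs.\<close>

definition W_dual_norm ::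
    "('v::real_inner \<Rightarrow>\<^sub>L 'h::real_inner) \<Rightarrow> real \<Rightarrow> real \<Rightarrow> ('v \<Rightarrow>\<^sub>L real) \<Rightarrow> real" where
  "W_dual_norm j lV lH \<phi> = Sup (insert 0 {\<phi> x / W_norm j lV lH x | x. x \<noteq> 0})"

text \<open>Existence and uniqueness of the representing element are given by the Riesz theorem whenever
  \<open>W_inner j lV lH\<close> is a scalar product whose norm is equivalent to the one of \<open>V\<close>.\<close>

definition W_riesz ::
    "('v::real_inner \<Rightarrow>\<^sub>L 'h::real_inner) \<Rightarrow> real \<Rightarrow> real \<Rightarrow> ('v \<Rightarrow>\<^sub>L real) \<Rightarrow> 'v" where
  "W_riesz j lV lH \<phi> = (THE w. \<forall>v. W_inner j lV lH w v = \<phi> v)"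

definition CBC :: "'a::real_normed_vector set set" where
  "CBC = {S. S \<noteq> {} \<and> closed S \<and> bounded S \<and> convex S}"

definition weakly_tendsto :: "(nat \<Rightarrow> 'v::real_normed_vector) \<Rightarrow> 'v \<Rightarrow> bool" where
  "weakly_tendsto xs x \<longleftrightarrow> (\<forall>\<phi> :: 'v \<Rightarrow>\<^sub>L real. (\<lambda>k. \<phi> (xs k)) \<longlonglongrightarrow> \<phi> x)"

text \<open>Compact upper hemicontinuity on \<open>M\<close> with respect to a pairing \<open>p\<close>, which is to be
  \<open>blinfun_apply\<close> for values in \<open>V\<^sup>*\<close> and the inner product for values in \<open>H\<close>.\<close>

definition c_uhc ::
    "('b \<Rightarrow> 'c \<Rightarrow> real) \<Rightarrow> 'v::real_normed_vector set \<Rightarrow> ('v \<Rightarrow> 'b set) \<Rightarrow> bool" where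
  "c_uhc p M F \<longleftrightarrow>
     (\<forall>xs x. (\<forall>k. xs k \<in> M) \<and> x \<in> M \<and> weakly_tendsto xs x \<longrightarrow>
        (\<forall>v. limsup (\<lambda>k. SUP y \<in> F (xs k). ereal (p y v)) \<le> (SUP y \<in> F x. ereal (p y v))))"

definition bounded_map :: "'v set \<Rightarrow> ('v \<Rightarrow> 'b::real_normed_vector set) \<Rightarrow> bool" where
  "bounded_map M F \<longleftrightarrow> bounded (\<Union>x\<in>M. F x)"

definition sum_map ::
    "('v::real_inner \<Rightarrow>\<^sub>L 'h::real_inner) \<Rightarrow> ('v \<Rightarrow> ('v \<Rightarrow>\<^sub>L real) set) \<Rightarrow> ('v \<Rightarrow> 'h set) \<Rightarrow>
      'v \<Rightarrow> ('v \<Rightarrow>\<^sub>L real) set" where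
  "sum_map j FV FH v = {yV + dual_embed j yH | yV yH. yV \<in> FV v \<and> yH \<in> FH v}"

end

theory Submission
  imports Defs
begin

text \<open>
  Write \<open>d = x - xt\<close> for the displacement, \<open>b\<close> for the scalar product \<open>W_inner\<close> and \<open>w\<close> for the
  Riesz representative of \<open>yb - yt\<close> with respect to \<open>b\<close>. Adding the two one-sided inequalities shows
  that every \<open>x\<close> in the ball \<open>M\<close> admits some \<open>\<phi> \<in> F x - yb\<close> with \<open>\<phi> d \<le> - b (d + w) d\<close>. The
  points with \<open>b (d + w) d \<le> 0\<close> form exactly the ball of centre \<open>x\<^sub>c\<close> and radius half the \<open>W\<close>-norm
  of \<open>w\<close>, in which the solution is sought. Some \<open>\<phi>\<close> points strictly inwards, \<open>\<phi> d < 0\<close>, wherever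
  \<open>x \<in> M\<close> is outside this small ball.

  The solution is found by a Galerkin argument. On a finite-dimensional ball, the theorem of Knaster,
  Kuratowski and Mazurkiewicz (\<open>kkm_compact\<close>) yields a variational inequality. It is applied to the
  values of \<open>F - yb\<close> truncated by \<open>\<phi> d \<le> - b (d + w) d\<close>, because an unrestricted zero of \<open>F - yb\<close>
  could lie outside the small ball. The truncation enters only through a Lagrange multiplier
  (\<open>penalised\<close>). In the finite-dimensional solution \<open>xt + d\<close> (\<open>galerkin\<close>), no direction \<open>v\<close> of the
  finite-dimensional space makes \<open>\<phi> v\<close> strictly negative uniformly for \<open>\<phi> \<in> F (xt + d) - yb\<close>, and
  \<open>d\<close> satisfies \<open>b (d + w) d \<le> 0\<close>. Both properties pass to the weak limit of a subsequence, the first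
  by compact upper hemicontinuity, the second by convexity (\<open>exists_weak_zero\<close>). If \<open>yb\<close> were not in
  \<open>F\<close> at the limit, a separating direction would contradict the first property
  (\<open>separate_from_sum\<close>).

  The underlying facts on Hilbert spaces (the Riesz theorem for coercive forms, the separation of a
  point from the sum of two closed bounded convex sets, weak sequential compactness of bounded sets)
  all rest on one lemma: decreasing sequences of nonempty closed bounded convex sets have nonempty
  intersection (\<open>nested_closed_convex_nonempty\<close>). The theorem of Knaster, Kuratowski and Mazurkiewicz
  is derived from Kuhn's combinatorial lemma.
\<close>

section \<open>The theorems of Poincare--Miranda and Knaster--Kuratowski--Mazurkiewicz\<close>

lemma tendsto_fun_iff:
  fixes f :: "'a \<Rightarrow> 'i \<Rightarrow> 'b::topological_space"
  shows "(f \<longlongrightarrow> l) F \<longleftrightarrow> (\<forall>i. ((\<lambda>k. f k i) \<longlongrightarrow> l i) F)"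
  using limitin_componentwise[of "\<lambda>_::'i. euclidean :: 'b topology" UNIV f l F]
  by (auto simp: euclidean_product_topology limitin_canonical_iff)

lemma compact_function_box:
  fixes a b :: "nat \<Rightarrow> real"
  shows "compact {t. \<forall>i. t i \<in> {a i..b i}}"
proof -
  have "compactin (product_topology (\<lambda>_. euclidean) UNIV) (PiE UNIV (\<lambda>i. {a i..b i}))"
    by (subst compactin_PiE) auto
  moreover have "PiE UNIV (\<lambda>i. {a i..b i}) = {t. \<forall>i. t i \<in> {a i..b i}}"
    by (auto simp: PiE_def Pi_def extensional_def)
  ultimately show ?thesis
    by (simp add: euclidean_product_topology)
qed

text \<open>
  Points are functions on \<open>nat\<close>, so that the dimension \<open>n\<close> is a term and not a type. There is no
  boundary condition on the coordinates from \<open>n\<close> on, which are parameters.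
\<close>

proposition poincare_miranda:
  fixes f :: "nat \<Rightarrow> (nat \<Rightarrow> real) \<Rightarrow> real"
  assumes cont: "\<And>i. i < n \<Longrightarrow> continuous_on {t. \<forall>i. t i \<in> {0..1}} (f i)"
    and lo: "\<And>i t. i < n \<Longrightarrow> \<forall>i. t i \<in> {0..1} \<Longrightarrow> t i = 0 \<Longrightarrow> 0 \<le> f i t"
    and hi: "\<And>i t. i < n \<Longrightarrow> \<forall>i. t i \<in> {0..1} \<Longrightarrow> t i = 1 \<Longrightarrow> f i t \<le> 0"
  obtains t where "\<forall>i. t i \<in> {0..1}" "\<forall>i<n. f i t = 0"
proof -
  define C :: "(nat \<Rightarrow> real) set" where "C = {t. \<forall>i. t i \<in> {0..1}}"
  have "compact C"
    using compact_function_box[of "\<lambda>_. 0" "\<lambda>_. 1"] by (simp add: C_def)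
  \<comment> \<open>A grid point \<open>x\<close> of mesh \<open>1 / p\<close>, cut off so that it lies in the cube for arbitrary \<open>x\<close>.\<close>
  define pt where "pt p x = (\<lambda>i. if i < n then min 1 (real (x i) / real p) else 0)"
    for p :: nat and x :: "nat \<Rightarrow> nat"
  have ptC: "pt p x \<in> C" for p x
    by (auto simp: pt_def C_def)
  \<comment> \<open>Kuhn's lemma, with labels given by the sign of \<open>f i\<close>, finds a small cell in which every \<open>f i\<close>
    changes its sign.\<close>
  have grid: "\<exists>q. (\<forall>i<n. \<exists>r s. (\<forall>j<n. q j \<le> r j \<and> r j \<le> q j + 1) \<and>
      (\<forall>j<n. q j \<le> s j \<and> s j \<le> q j + 1) \<and> 0 \<le> f i (pt p r) \<and> f i (pt p s) \<le> 0)"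
    if "p > 0" for p
  proof -
    define lab where "lab x i = (if x i \<noteq> p \<and> 0 \<le> f i (pt p x) then 0 else 1 :: nat)" for x i
    have L1: "f i (pt p x) \<le> 0" if "lab x i = 1" "i < n" for x i
    proof (cases "x i = p")
      case True
      then have "pt p x i = 1"
        using that \<open>p > 0\<close> by (simp add: pt_def)
      then show ?thesis
        using hi that ptC by (auto simp: C_def)
    qed (use that in \<open>auto simp: lab_def split: if_splits\<close>)
    have L0: "0 \<le> f i (pt p x)" if "lab x i = 0" for x i
      using that by (auto simp: lab_def split: if_splits)
    have Lor: "lab x i = 0 \<or> lab x i = 1" for x i
      by (auto simp: lab_def)
    have Lz: "lab x i = 0" if "x i = 0" "i < n" for x i
    proof -
      have "pt p x i = 0"
        using that by (simp add: pt_def)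
      then have "0 \<le> f i (pt p x)"
        using lo that ptC by (auto simp: C_def)
      then show ?thesis
        using that \<open>p > 0\<close> by (simp add: lab_def)
    qed
    have Lp: "lab x i = 1" if "x i = p" for x i
      using that by (simp add: lab_def)
    obtain q where q: "\<forall>i<n. \<exists>r s. (\<forall>j<n. q j \<le> r j \<and> r j \<le> q j + 1) \<and>
      (\<forall>j<n. q j \<le> s j \<and> s j \<le> q j + 1) \<and> lab r i \<noteq> lab s i"
      by (rule kuhn_lemma[OF \<open>p > 0\<close>, of n lab]) (use Lor Lz Lp in blast)+
    have "\<exists>r s. (\<forall>j<n. q j \<le> r j \<and> r j \<le> q j + 1) \<and>
      (\<forall>j<n. q j \<le> s j \<and> s j \<le> q j + 1) \<and> 0 \<le> f i (pt p r) \<and> f i (pt p s) \<le> 0"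
      if "i < n" for i
    proof -
      obtain r s where rs: "\<forall>j<n. q j \<le> r j \<and> r j \<le> q j + 1"
        "\<forall>j<n. q j \<le> s j \<and> s j \<le> q j + 1" "lab r i \<noteq> lab s i"
        using q \<open>i < n\<close> by blast
      consider "lab r i = 0" "lab s i = 1" | "lab r i = 1" "lab s i = 0"
        using rs(3) Lor[of r i] Lor[of s i] by fastforce
      then show ?thesis
      proof cases
        case 1
        then show ?thesis
          using rs L0[of r i] L1[of s i] \<open>i < n\<close> by blast
      next
        case 2
        then show ?thesis
          using rs L0[of s i] L1[of r i] \<open>i < n\<close> by blast
      qed
    qed
    then show ?thesis
      by blast
  qed
  define step where "step p q i y \<longleftrightarrow>
    (\<forall>j<n. q j \<le> fst y j \<and> fst y j \<le> q j + 1) \<and> (\<forall>j<n. q j \<le> snd y j \<and> snd y j \<le> q j + 1) \<and>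
    0 \<le> f i (pt p (fst y)) \<and> f i (pt p (snd y)) \<le> 0" for p q i y
  have "\<forall>k. \<exists>q. \<forall>i. \<exists>y. i < n \<longrightarrow> step (Suc k) q i y"
  proof
    fix k
    obtain q where q: "\<forall>i<n. \<exists>r s. (\<forall>j<n. q j \<le> r j \<and> r j \<le> q j + 1) \<and>
        (\<forall>j<n. q j \<le> s j \<and> s j \<le> q j + 1) \<and> 0 \<le> f i (pt (Suc k) r) \<and> f i (pt (Suc k) s) \<le> 0"
      using grid[of "Suc k"] by auto
    have "\<exists>y. step (Suc k) q i y" if "i < n" for i
      using q that unfolding step_def by fastforce
    then show "\<exists>q. \<forall>i. \<exists>y. i < n \<longrightarrow> step (Suc k) q i y"
      by blast
  qed
  then obtain q g where g: "\<And>k i. i < n \<Longrightarrow> step (Suc k) (q k) i (g k i)"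
    unfolding choice_iff by blast
  define r where "r k i = fst (g k i)" for k i
  define s where "s k i = snd (g k i)" for k i
  have r: "\<And>k i j. i < n \<Longrightarrow> j < n \<Longrightarrow> q k j \<le> r k i j \<and> r k i j \<le> q k j + 1"
    and s: "\<And>k i j. i < n \<Longrightarrow> j < n \<Longrightarrow> q k j \<le> s k i j \<and> s k i j \<le> q k j + 1"
    and fr: "\<And>k i. i < n \<Longrightarrow> 0 \<le> f i (pt (Suc k) (r k i))"
    and fs: "\<And>k i. i < n \<Longrightarrow> f i (pt (Suc k) (s k i)) \<le> 0"
    using g unfolding step_def r_def s_def by blast+
  obtain t \<sigma> where t: "t \<in> C" "strict_mono \<sigma>" "((\<lambda>k. pt (Suc k) (q k)) \<circ> \<sigma>) \<longlonglongrightarrow> t"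
    using seq_compactE[of C "\<lambda>k. pt (Suc k) (q k)"] \<open>compact C\<close> ptC
    by (auto simp: compact_eq_seq_compact_metric)
  have near: "(\<lambda>k. pt (Suc (\<sigma> k)) (y (\<sigma> k))) \<longlonglongrightarrow> t"
    if y: "\<And>k j. j < n \<Longrightarrow> q k j \<le> y k j \<and> y k j \<le> q k j + 1" for y
    unfolding tendsto_fun_iff
  proof
    fix j
    have lim: "(\<lambda>k. pt (Suc (\<sigma> k)) (q (\<sigma> k)) j) \<longlonglongrightarrow> t j"
      using t(3) by (simp add: tendsto_fun_iff o_def)
    have "(\<lambda>k. pt (Suc (\<sigma> k)) (y (\<sigma> k)) j - pt (Suc (\<sigma> k)) (q (\<sigma> k)) j) \<longlonglongrightarrow> 0"
    proof (rule Lim_null_comparison)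
      show "(\<lambda>k. inverse (real (Suc (\<sigma> k)))) \<longlonglongrightarrow> 0"
        using LIMSEQ_subseq_LIMSEQ[OF LIMSEQ_inverse_real_of_nat t(2)] by (simp add: o_def)
      have "norm (pt (Suc m) (y m) j - pt (Suc m) (q m) j) \<le> inverse (real (Suc m))" for m
      proof (cases "j < n")
        case True
        define a b where "a = real (y m j) / real (Suc m)" and "b = real (q m j) / real (Suc m)"
        have "b \<le> a" "a \<le> b + inverse (real (Suc m))"
          using y[OF True, of m]
          by (auto simp: a_def b_def divide_simps simp flip: of_nat_Suc intro!: divide_right_mono)
        then have "\<bar>min 1 a - min 1 b\<bar> \<le> inverse (real (Suc m))"
          by linarith
        then show ?thesis
          using True by (simp only: pt_def a_def b_def if_True real_norm_def)
      qed (simp add: pt_def)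
      then show "\<forall>\<^sub>F k in sequentially. norm (pt (Suc (\<sigma> k)) (y (\<sigma> k)) j - pt (Suc (\<sigma> k)) (q (\<sigma> k)) j)
          \<le> inverse (real (Suc (\<sigma> k)))"
        by simp
    qed
    from tendsto_add[OF this lim] show "(\<lambda>k. pt (Suc (\<sigma> k)) (y (\<sigma> k)) j) \<longlonglongrightarrow> t j"
      by simp
  qed
  have "f i t = 0" if "i < n" for i
  proof (rule antisym)
    have lim: "(\<lambda>k. f i (pt (Suc (\<sigma> k)) (y (\<sigma> k)))) \<longlonglongrightarrow> f i t"
      if "\<And>k j. j < n \<Longrightarrow> q k j \<le> y k j \<and> y k j \<le> q k j + 1" for y
    proof -
      have "continuous_on C (f i)"
        using cont[OF \<open>i < n\<close>] by (simp add: C_def)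
      from continuous_on_tendsto_compose[OF this near[OF that] t(1)] show ?thesis
        using ptC by simp
    qed
    show "f i t \<le> 0"
      by (rule tendsto_upperbound[OF lim[of "\<lambda>k. s k i"]]) (use s fs that in auto)
    show "0 \<le> f i t"
      by (rule tendsto_lowerbound[OF lim[of "\<lambda>k. r k i"]]) (use r fr that in auto)
  qed
  then show ?thesis
    using t(1) that by (auto simp: C_def)
qed

text \<open>
  If the sets \<open>T z\<close> had no common point in the convex hull, the distances to them, normalised to have
  the sum 1, would be continuous weights. A point whose barycentric coordinates agree with its own
  weights then contradicts the covering assumption. It is found in the cube of
  all coordinates, without reference to a basis or to the affine dimension of \<open>Z\<close>.
\<close>

proposition kkm_finite:
  fixes T :: "'a::real_normed_vector \<Rightarrow> 'a set"
  assumes fin: "finite Z" and ne: "Z \<noteq> {}" and cl: "\<And>z. z \<in> Z \<Longrightarrow> closed (T z)"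
    and cover: "\<And>J. J \<subseteq> Z \<Longrightarrow> convex hull J \<subseteq> (\<Union>z\<in>J. T z)"
  shows "\<exists>x \<in> convex hull Z. \<forall>z\<in>Z. x \<in> T z"
proof (rule ccontr)
  assume "\<not> ?thesis"
  then have none: "\<exists>z\<in>Z. x \<notin> T z" if "x \<in> convex hull Z" for x
    using that by blast
  have Tne: "T z \<noteq> {}" if "z \<in> Z" for z
    using cover[of "{z}"] that by auto
  define D where "D x = (\<Sum>z\<in>Z. infdist x (T z))" for x
  have Dpos: "D x > 0" if x: "x \<in> convex hull Z" for x
  proof -
    obtain z where z: "z \<in> Z" "x \<notin> T z"
      using none[OF x] by blast
    then have "infdist x (T z) > 0"
      by (intro infdist_pos_not_in_closed cl Tne)
    then show ?thesis
      unfolding D_def using z fin by (intro sum_pos2[of _ z]) (auto simp: infdist_nonneg)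
  qed
  obtain h :: "nat \<Rightarrow> 'a" and n where h: "bij_betw h {..<n} Z"
    using ex_bij_betw_nat_finite[OF fin] by (auto simp: atLeast0LessThan)
  obtain z0 where z0: "z0 \<in> Z"
    using ne by blast
  have hZ: "h i \<in> Z" if "i < n" for i
    using h that by (auto simp: bij_betw_def)
  define S where "S t = (\<Sum>i<n. t i)" for t :: "nat \<Rightarrow> real"
  \<comment> \<open>A continuous map of the whole cube into the hull that is \<open>\<Sum>i<n. t i *\<^sub>R h i\<close> if the
    coordinates have the sum 1.\<close>
  define X where "X t = (1 / max 1 (S t)) *\<^sub>R ((\<Sum>i<n. t i *\<^sub>R h i) + max 0 (1 - S t) *\<^sub>R z0)" for t
  let ?C = "{t::nat \<Rightarrow> real. \<forall>i. t i \<in> {0..1}}"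
  have XZ: "X t \<in> convex hull Z" if t: "t \<in> ?C" for t
  proof (cases "S t \<le> 1")
    case True
    have "X t = (\<Sum>i\<in>{..n}. (if i < n then t i else 1 - S t) *\<^sub>R (if i < n then h i else z0))"
      using True by (simp add: X_def lessThan_Suc_atMost[symmetric])
    also have "\<dots> \<in> convex hull Z"
      using t True hZ z0
      by (intro convex_sum) (auto simp: lessThan_Suc_atMost[symmetric] S_def intro: hull_inc)
    finally show ?thesis .
  next
    case False
    have "X t = (\<Sum>i<n. (t i / S t) *\<^sub>R h i)"
      using False by (simp add: X_def scaleR_sum_right)
    also have "\<dots> \<in> convex hull Z"
    proof (rule convex_sum)
      show "(\<Sum>i<n. t i / S t) = 1"
        using False by (simp add: S_def flip: sum_divide_distrib)
    qed (use t False hZ in \<open>auto intro: hull_inc\<close>)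
    finally show ?thesis .
  qed
  have contX: "continuous_on ?C X"
    unfolding X_def S_def
    by (intro continuous_intros continuous_on_product_coordinates continuous_on_subset[OF continuous_on_product_coordinates])
       (auto simp: max_def)
  define f where "f i t = infdist (X t) (T (h i)) / D (X t) - t i" for i t
  obtain t where t: "t \<in> ?C" "\<forall>i<n. f i t = 0"
  proof (rule poincare_miranda[of n f])
    fix i assume "i < n"
    have "D (X t) \<noteq> 0" if "t \<in> ?C" for t
      using Dpos[OF XZ[OF that]] by simp
    then show "continuous_on ?C (f i)"
      unfolding f_def D_def
      by (intro continuous_intros contX continuous_on_subset[OF continuous_on_product_coordinates]) auto
  next
    fix i and t :: "nat \<Rightarrow> real" assume *: "i < n" "\<forall>i. t i \<in> {0..1}"
    then have D: "D (X t) > 0"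
      using Dpos XZ by simp
    then show "0 \<le> f i t" if "t i = 0"
      using that by (simp add: f_def infdist_nonneg)
    have "infdist (X t) (T (h i)) \<le> D (X t)"
      unfolding D_def using hZ[OF *(1)] fin
      by (intro member_le_sum) (auto simp: infdist_nonneg)
    then show "f i t \<le> 0" if "t i = 1"
      using that D by (simp add: f_def)
  qed auto
  have D: "D (X t) > 0"
    using Dpos XZ t(1) by blast
  have ti: "t i = infdist (X t) (T (h i)) / D (X t)" if "i < n" for i
    using t(2) that by (simp add: f_def)
  have "S t = (\<Sum>i<n. infdist (X t) (T (h i))) / D (X t)"
    unfolding S_def sum_divide_distrib using ti by simp
  also have "(\<Sum>i<n. infdist (X t) (T (h i))) = D (X t)"
    unfolding D_def by (rule sum.reindex_bij_betw[OF h])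
  finally have St: "S t = 1"
    using D by simp
  define I where "I = {i. i < n \<and> t i > 0}"
  have I0: "finite I" "I \<subseteq> {..<n}" "\<forall>i \<in> {..<n} - I. t i = 0"
  proof -
    have "0 \<le> t i" for i
      using t(1) by auto
    then show "\<forall>i \<in> {..<n} - I. t i = 0"
      by (auto simp: I_def less_le)
  qed (auto simp: I_def)
  have "X t = (\<Sum>i<n. t i *\<^sub>R h i)"
    using St by (simp add: X_def)
  also have "\<dots> = (\<Sum>i\<in>I. t i *\<^sub>R h i)"
    using I0 by (intro sum.mono_neutral_right) auto
  also have "\<dots> \<in> convex hull (h ` I)"
  proof (rule convex_sum)
    have "(\<Sum>i\<in>I. t i) = S t"
      unfolding S_def using I0 by (intro sum.mono_neutral_left) auto
    then show "(\<Sum>i\<in>I. t i) = 1"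
      using St by simp
  next
    fix i assume "i \<in> I"
    then show "0 \<le> t i" "h i \<in> convex hull (h ` I)"
      by (simp add: I_def) (simp add: \<open>i \<in> I\<close> hull_inc)
  qed (use I0 in simp_all)
  also have "\<dots> \<subseteq> (\<Union>z\<in>h ` I. T z)"
    using hZ by (intro cover) (auto simp: I_def)
  finally obtain i where i: "i \<in> I" "X t \<in> T (h i)"
    by blast
  then have "t i = 0"
    using ti[of i] by (simp add: I_def)
  then show False
    using i by (simp add: I_def)
qed

proposition kkm_compact:
  fixes T :: "'a::real_normed_vector \<Rightarrow> 'a set"
  assumes K: "compact K" "convex K" "K \<noteq> {}" and cl: "\<And>z. z \<in> K \<Longrightarrow> closed (T z)"
    and cover: "\<And>J. finite J \<Longrightarrow> J \<subseteq> K \<Longrightarrow> convex hull J \<subseteq> (\<Union>z\<in>J. T z)"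
  obtains x where "x \<in> K" "\<And>z. z \<in> K \<Longrightarrow> x \<in> T z"
proof -
  have "K \<inter> (\<Inter>z\<in>K. T z) \<noteq> {}"
  proof (rule compact_imp_fip_image[OF K(1) cl])
    fix Z assume Z: "finite Z" "Z \<subseteq> K"
    show "K \<inter> (\<Inter>z\<in>Z. T z) \<noteq> {}"
    proof (cases "Z = {}")
      case False
      have "\<exists>x \<in> convex hull Z. \<forall>z\<in>Z. x \<in> T z"
      proof (rule kkm_finite[OF Z(1) False])
        fix J assume "J \<subseteq> Z"
        then show "convex hull J \<subseteq> (\<Union>z\<in>J. T z)"
          using Z by (intro cover finite_subset[of J Z]) auto
      qed (use cl Z in auto)
      then obtain x where "x \<in> convex hull Z" "\<forall>z\<in>Z. x \<in> T z"
        by blast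
      moreover have "convex hull Z \<subseteq> K"
        using K Z by (simp add: hull_minimal)
      ultimately show ?thesis
        by blast
    qed (use K in auto)
  qed
  then show ?thesis
    using that by blast
qed

section \<open>Minimisation and the Riesz theorem in Hilbert spaces\<close>

text \<open>
  Almost minimal elements of the sets form a Cauchy sequence by the parallelogram law.
\<close>

lemma nested_closed_convex_nonempty:
  fixes S :: "nat \<Rightarrow> 'a::{real_inner,complete_space} set"
  assumes dec: "\<And>m n. m \<le> n \<Longrightarrow> S n \<subseteq> S m"
    and cl: "\<And>n. closed (S n)" and cv: "\<And>n. convex (S n)" and ne: "\<And>n. S n \<noteq> {}"
    and bd: "bounded (S 0)"
  shows "(\<Inter>n. S n) \<noteq> {}"
proof -
  define m where "m n = (INF x\<in>S n. (norm x)\<^sup>2)" for n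
  have bb: "bdd_below ((\<lambda>x. (norm x)\<^sup>2) ` S n)" for n
    by (rule bdd_belowI[of _ 0]) auto
  have m_le: "m n \<le> (norm x)\<^sup>2" if "x \<in> S n" for n x
    unfolding m_def by (rule cINF_lower[OF bb that])
  have m_inc: "m i \<le> m n" if "i \<le> n" for i n
    unfolding m_def by (rule cINF_superset_mono[OF ne bb]) (use dec[OF that] in auto)
  obtain B where B: "\<And>x. x \<in> S 0 \<Longrightarrow> norm x \<le> B"
    using bd by (auto simp: bounded_iff)
  have mB: "m n \<le> B\<^sup>2" for n
  proof -
    obtain x where x: "x \<in> S n"
      using ne by blast
    then have "norm x \<le> B"
      using B dec[of 0 n] by auto
    then have "(norm x)\<^sup>2 \<le> B\<^sup>2"
      by (simp add: power_mono)
    then show ?thesis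
      using m_le[OF x] by linarith
  qed
  have "convergent m"
    by (metis incseq_convergent[of m "B\<^sup>2"] m_inc mB incseq_def convergent_def)
  then have Cm: "Cauchy m"
    by (rule convergent_Cauchy)
  have "\<exists>x. x \<in> S n \<and> (norm x)\<^sup>2 < m n + 1 / real (Suc n)" for n
  proof -
    have "m n < m n + 1 / real (Suc n)"
      by simp
    from cInf_lessD[OF _ this[unfolded m_def]] ne[of n] show ?thesis
      unfolding m_def by auto
  qed
  then obtain x where x: "\<And>n. x n \<in> S n" "\<And>n. (norm (x n))\<^sup>2 < m n + 1 / real (Suc n)"
    by metis
  have xS: "x k \<in> S n" if "n \<le> k" for n k
    using x(1) dec[OF that] by blast
  have par: "(norm (x n - x k))\<^sup>2 \<le> 2 * (m k - m n) + 4 / real (Suc n)" if "n \<le> k" for n k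
  proof -
    have "(1/2) *\<^sub>R x n + (1/2) *\<^sub>R x k \<in> S n"
      using convexD[OF cv x(1) xS[OF that], of "1/2" "1/2"] by simp
    then have "m n \<le> (norm ((1/2) *\<^sub>R x n + (1/2) *\<^sub>R x k))\<^sup>2"
      by (rule m_le)
    also have "\<dots> = (norm (x n + x k))\<^sup>2 / 4"
      by (simp add: power_divide flip: scaleR_add_right)
    finally have 1: "4 * m n \<le> (norm (x n + x k))\<^sup>2"
      by simp
    have "(norm (x n - x k))\<^sup>2 = 2 * (norm (x n))\<^sup>2 + 2 * (norm (x k))\<^sup>2 - (norm (x n + x k))\<^sup>2"
      by (simp add: power2_norm_eq_inner inner_simps inner_commute)
    moreover have "1 / real (Suc k) \<le> 1 / real (Suc n)"
      using that by (simp add: divide_simps)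
    then have "(norm (x k))\<^sup>2 < m k + 1 / real (Suc n)"
      using x(2)[of k] by linarith
    ultimately have "(norm (x n - x k))\<^sup>2 \<le> 2 * (m k - m n) + 4 * (1 / real (Suc n))"
      using 1 x(2)[of n] by argo
    then show ?thesis
      by simp
  qed
  have "Cauchy x"
  proof (rule CauchyI')
    fix e :: real assume "e > 0"
    then have e: "e\<^sup>2 / 4 > 0"
      by simp
    obtain N1 where N1: "\<And>k n. k \<ge> N1 \<Longrightarrow> n \<ge> N1 \<Longrightarrow> norm (m k - m n) < e\<^sup>2 / 4"
      using CauchyD[OF Cm e] by blast
    obtain N2 :: nat where N2: "real N2 > 8 / e\<^sup>2"
      using reals_Archimedean2 by blast
    have "dist (x n) (x k) < e" if n: "n \<ge> max N1 N2" and k: "k > n" for n k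
    proof -
      have "real (Suc n) > 8 / e\<^sup>2"
        using N2 n by linarith
      then have "4 / real (Suc n) < e\<^sup>2 / 2"
        using \<open>e > 0\<close> by (simp add: field_simps)
      moreover have "m k - m n < e\<^sup>2 / 4"
        using N1[of k n] n k unfolding real_norm_def by linarith
      ultimately have "(norm (x n - x k))\<^sup>2 < e\<^sup>2"
        using par[of n k] k by simp
      then show ?thesis
        using \<open>e > 0\<close> by (simp add: dist_norm power_less_imp_less_base)
    qed
    then show "\<exists>M. \<forall>n\<ge>M. \<forall>k>n. dist (x n) (x k) < e"
      by blast
  qed
  then obtain l where l: "x \<longlonglongrightarrow> l"
    by (auto simp: Cauchy_convergent_iff convergent_def)
  have "l \<in> S n" for n
    by (rule Lim_in_closed_set[OF cl _ _ l])
       (auto simp: eventually_sequentially intro!: exI[of _ n] xS)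
  then show ?thesis
    by blast
qed

lemma quasiconvex_attains_inf:
  fixes f :: "'a::{real_inner,complete_space} \<Rightarrow> real"
  assumes ne: "S \<noteq> {}" and bdd: "\<And>x. x \<in> S \<Longrightarrow> c \<le> f x"
    and cl: "\<And>r. closed {x\<in>S. f x \<le> r}" and cv: "\<And>r. convex {x\<in>S. f x \<le> r}"
    and bd: "\<And>r. bounded {x\<in>S. f x \<le> r}"
  obtains z where "z \<in> S" "\<And>x. x \<in> S \<Longrightarrow> f z \<le> f x"
proof -
  define m where "m = (INF x\<in>S. f x)"
  have m: "m \<le> f x" if "x \<in> S" for x
    unfolding m_def using that bdd by (intro cINF_lower bdd_belowI[of _ c]) auto
  have "(\<Inter>n. {x\<in>S. f x \<le> m + 1 / real (Suc n)}) \<noteq> {}"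
  proof (rule nested_closed_convex_nonempty)
    fix i n :: nat assume "i \<le> n"
    then have "1 / real (Suc n) \<le> 1 / real (Suc i)"
      by (simp add: divide_simps)
    then show "{x \<in> S. f x \<le> m + 1 / real (Suc n)} \<subseteq> {x \<in> S. f x \<le> m + 1 / real (Suc i)}"
      by auto
  next
    fix n
    have "(INF x\<in>S. f x) < m + 1 / real (Suc n)"
      by (simp add: m_def)
    from cInf_lessD[OF _ this] ne show "{x \<in> S. f x \<le> m + 1 / real (Suc n)} \<noteq> {}"
      by force
  qed (use cl cv bd in auto)
  then obtain z where z: "z \<in> S" "\<And>n. f z \<le> m + 1 / real (Suc n)"
    by blast
  have "f z \<le> m"
    using LIMSEQ_inverse_real_of_nat_add[of m] z(2)
    by (intro tendsto_lowerbound[OF LIMSEQ_inverse_real_of_nat_add]) (auto simp: inverse_eq_divide)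
  then show ?thesis
    using that z m by (meson order_trans)
qed

text \<open>
  A symmetric bounded coercive form, that is, a scalar product whose norm is equivalent to the given
  one.
\<close>

locale coercive_bilinear = bounded_bilinear b
  for b :: "'v::{real_inner,complete_space} \<Rightarrow> 'v \<Rightarrow> real" +
  fixes \<alpha> :: real
  assumes sym: "b x y = b y x"
    and \<alpha>_pos: "\<alpha> > 0"
    and coercive: "\<alpha> * (norm x)\<^sup>2 \<le> b x x"
begin

lemma nonneg: "0 \<le> b x x"
  using coercive[of x] \<alpha>_pos by (meson mult_nonneg_nonneg less_imp_le order_trans zero_le_power2)

lemma eq_zero: "b x x \<le> 0 \<Longrightarrow> x = 0"
  using coercive[of x] \<alpha>_pos
  by (metis mult_le_cancel_left_pos mult_zero_right norm_eq_zero order_trans power_eq_0_iff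
      zero_le_power2 order_antisym)

lemma pos: "x \<noteq> 0 \<Longrightarrow> 0 < b x x"
  using eq_zero[of x] by (metis not_le_imp_less)

lemma cauchy_schwarz: "b x y \<le> sqrt (b x x) * sqrt (b y y)"
proof (cases "x = 0 \<or> y = 0")
  case False
  define p q where "p = sqrt (b x x)" and "q = sqrt (b y y)"
  have pq: "p > 0" "q > 0" "p * p = b x x" "q * q = b y y"
    using False pos[of x] pos[of y] by (auto simp: p_def q_def)
  have "0 \<le> b (q *\<^sub>R x - p *\<^sub>R y) (q *\<^sub>R x - p *\<^sub>R y)"
    by (rule nonneg)
  also have "\<dots> = (q * q) * b x x + (p * p) * b y y - 2 * (p * q) * b x y"
    by (simp add: diff_left diff_right scaleR_left scaleR_right sym[of y x] algebra_simps)
  also have "\<dots> = 2 * (p * q) * (p * q - b x y)"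
    unfolding pq(3,4)[symmetric] by (simp add: algebra_simps)
  finally have "0 \<le> p * q - b x y"
    using mult_pos_pos[OF pq(1,2)] by (auto simp: zero_le_mult_iff)
  then show ?thesis
    by (simp add: p_def q_def)
qed (auto simp: zero_left zero_right)

lemma quadratic_convex:
  assumes "u + v = 1" "0 \<le> u" "0 \<le> v"
  shows "b (u *\<^sub>R x + v *\<^sub>R y) (u *\<^sub>R x + v *\<^sub>R y) \<le> u * b x x + v * b y y"
proof -
  have u: "u = 1 - v"
    using assms by simp
  have "u * b x x + v * b y y - b (u *\<^sub>R x + v *\<^sub>R y) (u *\<^sub>R x + v *\<^sub>R y) = u * v * b (x - y) (x - y)"
    unfolding u
    by (simp add: add_left add_right diff_left diff_right scaleR_left scaleR_right sym[of y x])
       (simp add: algebra_simps)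
  moreover have "0 \<le> u * v * b (x - y) (x - y)"
    using assms nonneg by simp
  ultimately show ?thesis
    by linarith
qed

lemma continuous_quadratic: "continuous_on S (\<lambda>x. b x x)"
  by (intro continuous_on continuous_intros)

text \<open>
  The representing element is the minimiser of \<open>\<lambda>v. b v v - 2 * \<phi> v\<close>.
\<close>

lemma riesz: "\<exists>!w. \<forall>v. b w v = blinfun_apply \<phi> v"
proof -
  define Q where "Q v = b v v - 2 * \<phi> v" for v
  have lower: "\<alpha> * (norm v)\<^sup>2 - 2 * norm \<phi> * norm v \<le> Q v" for v
  proof -
    have "\<phi> v \<le> norm \<phi> * norm v"
      using norm_blinfun[of \<phi> v] by (auto simp: abs_le_iff)
    then show ?thesis
      unfolding Q_def using coercive[of v] by linarith
  qed
  obtain z where z: "\<And>x. Q z \<le> Q x"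
  proof (rule quasiconvex_attains_inf[of UNIV "- (norm \<phi>)\<^sup>2 / \<alpha>" Q])
    fix v :: 'v
    have "0 \<le> (\<alpha> * norm v - norm \<phi>)\<^sup>2 / \<alpha>"
      using \<alpha>_pos by simp
    also have "\<dots> = \<alpha> * (norm v)\<^sup>2 - 2 * norm \<phi> * norm v + (norm \<phi>)\<^sup>2 / \<alpha>"
      using \<alpha>_pos by (simp add: power2_diff field_simps power2_eq_square)
    finally show "- (norm \<phi>)\<^sup>2 / \<alpha> \<le> Q v"
      using lower[of v] by simp
  next
    fix r
    show "closed {x \<in> UNIV. Q x \<le> r}"
      unfolding Q_def by (simp, intro closed_Collect_le continuous_intros continuous_quadratic)
    show "convex {x \<in> UNIV. Q x \<le> r}"
    proof (rule convexI, clarsimp)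
      fix x y u v assume *: "Q x \<le> r" "Q y \<le> r" "0 \<le> u" "0 \<le> v" "u + v = (1::real)"
      have "Q (u *\<^sub>R x + v *\<^sub>R y) \<le> u * Q x + v * Q y"
        using quadratic_convex[of u v x y] *
        by (simp add: Q_def blinfun.add_right blinfun.scaleR_right algebra_simps)
      also have "\<dots> \<le> u * r + v * r"
        using * by (intro add_mono mult_left_mono) auto
      finally show "Q (u *\<^sub>R x + v *\<^sub>R y) \<le> r"
        using * by (simp flip: distrib_right)
    qed
    have "norm x \<le> 1 + (\<bar>r\<bar> + 2 * norm \<phi>) / \<alpha>" if "Q x \<le> r" for x
    proof (cases "norm x \<le> 1")
      case True
      then show ?thesis
        using \<alpha>_pos by (simp add: add_increasing2)
    next
      case False
      have "\<alpha> * norm x * norm x \<le> \<bar>r\<bar> + 2 * norm \<phi> * norm x"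
        using lower[of x] that by (simp add: power2_eq_square mult.assoc)
      also have "\<dots> \<le> (\<bar>r\<bar> + 2 * norm \<phi>) * norm x"
        using False mult_left_mono[of 1 "norm x" "\<bar>r\<bar>"] by (simp add: distrib_right)
      finally have "\<alpha> * norm x \<le> \<bar>r\<bar> + 2 * norm \<phi>"
        by (rule mult_right_le_imp_le) (use False in linarith)
      then have "norm x \<le> (\<bar>r\<bar> + 2 * norm \<phi>) / \<alpha>"
        using \<alpha>_pos by (simp add: field_simps)
      then show ?thesis
        by simp
    qed
    then show "bounded {x \<in> UNIV. Q x \<le> r}"
      by (auto intro!: boundedI)
  qed auto
  have "b z v = \<phi> v" for v
  proof -
    define A B where "A = b v v" and "B = b z v - \<phi> v"
    have quad: "0 \<le> t * t * A + 2 * t * B" for t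
    proof -
      have "Q (z + t *\<^sub>R v) - Q z = t * t * A + 2 * t * B"
        by (simp add: Q_def A_def B_def add_left add_right scaleR_left scaleR_right
            blinfun.add_right blinfun.scaleR_right sym[of v z] algebra_simps)
      then show ?thesis
        using z[of "z + t *\<^sub>R v"] by linarith
    qed
    have "0 \<le> A"
      unfolding A_def by (rule nonneg)
    \<comment> \<open>This \<open>t\<close> makes the quadratic negative unless \<open>B = 0\<close>. Adding 1 to \<open>A\<close> avoids the case
      \<open>A = 0\<close>.\<close>
    define t where "t = - B / (A + 1)"
    have t: "t * (A + 1) = - B"
      using \<open>0 \<le> A\<close> by (simp add: t_def)
    have "0 \<le> (t * t * A + 2 * t * B) * ((A + 1) * (A + 1))"
      using quad \<open>0 \<le> A\<close> by (intro mult_nonneg_nonneg) auto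
    also have "\<dots> = (t * (A + 1)) * (t * (A + 1)) * A + 2 * (t * (A + 1)) * B * (A + 1)"
      by (simp add: algebra_simps)
    also have "\<dots> = - (B * B) * (A + 2)"
      unfolding t by (simp add: algebra_simps)
    finally have "B * B \<le> 0"
      using \<open>0 \<le> A\<close> by (simp add: mult_le_0_iff zero_le_mult_iff)
    then show ?thesis
      by (auto simp: B_def mult_le_0_iff)
  qed
  moreover have "w = z" if "\<forall>v. b w v = \<phi> v" for w
  proof -
    have "b (w - z) (w - z) = 0"
      using that \<open>\<And>v. b z v = \<phi> v\<close> by (simp add: diff_left)
    then show ?thesis
      using eq_zero[of "w - z"] by simp
  qed
  ultimately show ?thesis
    by blast
qed

end

interpretation inner_form: coercive_bilinear
  "inner :: 'v::{real_inner,complete_space} \<Rightarrow> 'v \<Rightarrow> real" 1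
proof -
  interpret bounded_bilinear "inner :: 'v \<Rightarrow> 'v \<Rightarrow> real"
    by (rule bounded_bilinear_inner)
  show "coercive_bilinear (inner :: 'v \<Rightarrow> 'v \<Rightarrow> real) 1"
    by unfold_locales (auto simp: inner_commute power2_norm_eq_inner)
qed

lemma blinfun_as_inner:
  fixes \<phi> :: "'v::{real_inner,complete_space} \<Rightarrow>\<^sub>L real"
  obtains w where "\<phi> = blinfun_inner_left w"
proof -
  obtain w where "\<forall>v. w \<bullet> v = \<phi> v"
    using inner_form.riesz[of \<phi>] by blast
  then have "\<phi> = blinfun_inner_left w"
    by (intro blinfun_eqI) (simp add: inner_commute)
  then show ?thesis
    by (rule that)
qed

lemma norm_blinfun_inner_left [simp]: "norm (blinfun_inner_left w) = norm w"
proof (rule antisym)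
  show "norm (blinfun_inner_left w) \<le> norm w"
    by (rule norm_blinfun_bound) (auto simp: mult.commute Cauchy_Schwarz_ineq2 inner_commute)
  show "norm w \<le> norm (blinfun_inner_left w)"
  proof (cases "w = 0")
    case False
    have "norm w * norm w \<le> norm (blinfun_inner_left w) * norm w"
      using norm_blinfun[of "blinfun_inner_left w" w]
      by (simp add: power2_norm_eq_inner[symmetric] power2_eq_square)
    then show ?thesis
      using False by simp
  qed simp
qed

section \<open>Weak convergence, compactness and separation\<close>

lemma weakly_tendsto_inner:
  fixes x :: "'v::{real_inner,complete_space}"
  assumes "\<And>v. (\<lambda>k. xs k \<bullet> v) \<longlonglongrightarrow> x \<bullet> v"
  shows "weakly_tendsto xs x"
  unfolding weakly_tendsto_def
proof
  fix \<phi> :: "'v \<Rightarrow>\<^sub>L real"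
  obtain w where "\<phi> = blinfun_inner_left w"
    by (rule blinfun_as_inner)
  then show "(\<lambda>k. \<phi> (xs k)) \<longlonglongrightarrow> \<phi> x"
    using assms[of w] by simp
qed

lemma tendsto_imp_weakly_tendsto: "xs \<longlonglongrightarrow> x \<Longrightarrow> weakly_tendsto xs x"
  unfolding weakly_tendsto_def by (auto intro: blinfun.tendsto)

text \<open>
  A subsequence is chosen such that the inner products with all members of a dense sequence converge.
  Every point in the intersection of the closed convex hulls of its tails is then the weak limit.
\<close>

lemma bounded_has_weakly_convergent_subseq:
  fixes xs :: "nat \<Rightarrow> 'v::{real_inner,complete_space}"
  assumes bd: "\<And>k. norm (xs k) \<le> B" and dense: "closure (range (e :: nat \<Rightarrow> 'v)) = UNIV"
  obtains x \<sigma> where "strict_mono \<sigma>" "weakly_tendsto (\<lambda>k. xs (\<sigma> k)) x"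
proof -
  define t where "t k = (\<lambda>i. xs k \<bullet> e i)" for k
  have "t k \<in> {t. \<forall>i. t i \<in> {- (B * norm (e i))..B * norm (e i)}}" for k
  proof -
    have "\<bar>xs k \<bullet> e i\<bar> \<le> B * norm (e i)" for i
      using Cauchy_Schwarz_ineq2[of "xs k" "e i"] mult_right_mono[OF bd[of k], of "norm (e i)"] by simp
    then show ?thesis
      by (auto simp: t_def abs_le_iff minus_le_iff)
  qed
  then obtain l \<sigma> where \<sigma>: "strict_mono \<sigma>" and l: "(t \<circ> \<sigma>) \<longlonglongrightarrow> l"
    using compact_function_box[of "\<lambda>i. - (B * norm (e i))" "\<lambda>i. B * norm (e i)"]
    by (metis (no_types, lifting) compact_eq_seq_compact_metric seq_compactE)
  define y where "y k = xs (\<sigma> k)" for k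
  have lim: "(\<lambda>k. y k \<bullet> e i) \<longlonglongrightarrow> l i" for i
    using l by (simp add: tendsto_fun_iff t_def o_def y_def)
  have yB: "norm (y k) \<le> B" for k
    by (simp add: y_def bd)
  have "(\<Inter>n. closure (convex hull (y ` {n..}))) \<noteq> {}"
  proof (rule nested_closed_convex_nonempty)
    show "closure (convex hull y ` {n..}) \<subseteq> closure (convex hull y ` {m..})" if "m \<le> n" for m n
      using that by (intro closure_mono hull_mono image_mono) auto
    have "bounded (y ` {0..})"
      using yB by (auto intro: boundedI)
    then show "bounded (closure (convex hull y ` {0..}))"
      by (intro bounded_closure bounded_convex_hull)
  qed (auto intro: convex_closure)
  then obtain x where x: "\<And>n. x \<in> closure (convex hull (y ` {n..}))"
    by blast
  have tail: "x \<in> C" if C: "closed C" "convex C" "\<forall>\<^sub>F k in sequentially. y k \<in> C" for C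
  proof -
    obtain n where "\<And>k. k \<ge> n \<Longrightarrow> y k \<in> C"
      using C(3) by (auto simp: eventually_sequentially)
    then have "closure (convex hull (y ` {n..})) \<subseteq> C"
      using C by (intro closure_minimal hull_minimal) auto
    then show ?thesis
      using x by blast
  qed
  have xl: "x \<bullet> e i = l i" for i
  proof -
    have "\<bar>x \<bullet> e i - l i\<bar> \<le> r" if "r > 0" for r
    proof -
      have "x \<in> {u. e i \<bullet> u \<le> l i + r} \<inter> {u. e i \<bullet> u \<ge> l i - r}"
      proof (rule tail)
        show "\<forall>\<^sub>F k in sequentially. y k \<in> {u. e i \<bullet> u \<le> l i + r} \<inter> {u. e i \<bullet> u \<ge> l i - r}"
          using tendstoD[OF lim[of i] that]
          by eventually_elim (auto simp: dist_real_def inner_commute abs_less_iff)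
      qed (intro closed_Int convex_Int closed_halfspace_le closed_halfspace_ge
          convex_halfspace_le convex_halfspace_ge)+
      then show ?thesis
        by (auto simp: inner_commute)
    qed
    then have "\<bar>x \<bullet> e i - l i\<bar> \<le> 0"
      by (rule field_le_epsilon) simp
    then show ?thesis
      by simp
  qed
  have "(\<lambda>k. y k \<bullet> v) \<longlonglongrightarrow> x \<bullet> v" for v
  proof (rule tendstoI)
    fix r :: real assume "r > 0"
    define A where "A = \<bar>B\<bar> + norm x + 1"
    have "A > 0"
      by (simp add: A_def add_pos_nonneg add_nonneg_pos)
    have "v \<in> closure (range e)"
      using dense by simp
    then obtain i where i: "dist (e i) v < r / (2 * A)"
      using \<open>r > 0\<close> \<open>A > 0\<close>
      by (auto simp: closure_approachable dest!: spec[of _ "r / (2 * A)"])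
    have "\<forall>\<^sub>F k in sequentially. dist (y k \<bullet> e i) (x \<bullet> e i) < r / 2"
      using tendstoD[OF lim[of i], of "r/2"] \<open>r > 0\<close> by (simp add: xl)
    then show "\<forall>\<^sub>F k in sequentially. dist (y k \<bullet> v) (x \<bullet> v) < r"
    proof eventually_elim
      case (elim k)
      have "\<bar>(y k - x) \<bullet> (v - e i)\<bar> \<le> norm (y k - x) * norm (v - e i)"
        by (rule Cauchy_Schwarz_ineq2)
      also have "\<dots> \<le> A * (r / (2 * A))"
      proof (intro mult_mono)
        show "norm (y k - x) \<le> A"
          using norm_triangle_ineq4[of "y k" x] yB[of k] by (simp add: A_def)
        show "norm (v - e i) \<le> r / (2 * A)"
          using i by (simp add: dist_norm norm_minus_commute)
      qed (use \<open>A > 0\<close> in auto)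
      also have "\<dots> = r / 2"
        using \<open>A > 0\<close> by simp
      finally have "\<bar>(y k - x) \<bullet> (v - e i)\<bar> \<le> r / 2" .
      moreover have "y k \<bullet> v - x \<bullet> v = (y k - x) \<bullet> (v - e i) + (y k \<bullet> e i - x \<bullet> e i)"
        by (simp add: inner_simps)
      ultimately show ?case
        using elim unfolding dist_real_def by linarith
    qed
  qed
  then show ?thesis
    by (intro that[OF \<sigma>] weakly_tendsto_inner) (simp add: y_def)
qed

lemma compact_coefficient_box:
  fixes C :: "'a::real_normed_vector set"
  assumes "finite C"
  shows "compact {\<Sum>c\<in>C. a c *\<^sub>R c | a. \<forall>c\<in>C. \<bar>a c\<bar> \<le> r c}"
  using assms
proof induction
  case (insert c C)
  let ?S = "{\<Sum>c\<in>C. a c *\<^sub>R c | a. \<forall>c\<in>C. \<bar>a c\<bar> \<le> r c}"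
  let ?I = "(\<lambda>t. t *\<^sub>R c) ` {- r c..r c}"
  have "{\<Sum>c\<in>insert c C. a c *\<^sub>R c | a. \<forall>c\<in>insert c C. \<bar>a c\<bar> \<le> r c}
      = {x + y | x y. x \<in> ?I \<and> y \<in> ?S}" (is "?L = ?R")
  proof (intro equalityI subsetI)
    fix x assume "x \<in> ?L"
    then obtain a where "x = (\<Sum>c\<in>insert c C. a c *\<^sub>R c)" "\<forall>c\<in>insert c C. \<bar>a c\<bar> \<le> r c"
      by blast
    then have "x = a c *\<^sub>R c + (\<Sum>c\<in>C. a c *\<^sub>R c)" "a c *\<^sub>R c \<in> ?I" "(\<Sum>c\<in>C. a c *\<^sub>R c) \<in> ?S"
      using insert.hyps by (auto simp: abs_le_iff)
    then show "x \<in> ?R"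
      by blast
  next
    fix x assume "x \<in> ?R"
    then obtain t a where x: "x = t *\<^sub>R c + (\<Sum>c\<in>C. a c *\<^sub>R c)" "\<bar>t\<bar> \<le> r c" "\<forall>c\<in>C. \<bar>a c\<bar> \<le> r c"
      by (auto simp: abs_le_iff)
    have "x = (\<Sum>c'\<in>insert c C. (a(c := t)) c' *\<^sub>R c')"
      using insert.hyps x(1) by (auto intro!: sum.cong)
    moreover have "\<forall>c'\<in>insert c C. \<bar>(a(c := t)) c'\<bar> \<le> r c'"
      using x by auto
    ultimately show "x \<in> ?L"
      by blast
  qed
  moreover have "compact ?I"
    by (intro compact_continuous_image continuous_intros) auto
  ultimately show ?case
    using compact_sums[of ?I ?S] insert.IH by simp
qed simp

lemma compact_span_Int:
  fixes B :: "'a::real_inner set"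
  assumes "finite B" "closed S" "bounded S"
  shows "compact (span B \<inter> S)"
proof -
  obtain C0 where C0: "finite C0" "span C0 = span B" "pairwise orthogonal C0"
    using basis_orthogonal[OF assms(1)] by blast
  define C where "C = C0 - {0}"
  have C: "finite C" "span C = span B" "pairwise orthogonal C" "0 \<notin> C"
    using C0 by (auto simp: C_def span_delete_0 intro: pairwise_mono)
  obtain M where M: "\<And>x. x \<in> S \<Longrightarrow> norm x \<le> M"
    using assms(3) by (auto simp: bounded_iff)
  let ?D = "{\<Sum>c\<in>C. a c *\<^sub>R c | a. \<forall>c\<in>C. \<bar>a c\<bar> \<le> M / norm c}"
  have "span B \<inter> S \<subseteq> ?D"
  proof
    fix x assume x: "x \<in> span B \<inter> S"
    then obtain a where a: "x = (\<Sum>c\<in>C. a c *\<^sub>R c)"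
      using C(1) by (auto simp: span_finite simp flip: C(2))
    have "\<bar>a c\<bar> \<le> M / norm c" if "c \<in> C" for c
    proof -
      have "x \<bullet> c = (\<Sum>c'\<in>C. a c' * (c' \<bullet> c))"
        by (simp add: a inner_sum_left)
      also have "\<dots> = (\<Sum>c'\<in>C. if c' = c then a c * (c \<bullet> c) else 0)"
        using C(3) that by (intro sum.cong) (auto simp: pairwise_def orthogonal_def)
      finally have "x \<bullet> c = a c * (norm c)\<^sup>2"
        using C(1) that by (simp add: power2_norm_eq_inner)
      then have "\<bar>a c\<bar> * norm c * norm c = \<bar>x \<bullet> c\<bar>"
        by (simp add: abs_mult power2_eq_square)
      also have "\<dots> \<le> norm x * norm c"
        by (rule Cauchy_Schwarz_ineq2)
      also have "\<dots> \<le> M * norm c"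
        using M x by (simp add: mult_right_mono)
      finally have *: "\<bar>a c\<bar> * norm c * norm c \<le> M * norm c" .
      have "norm c > 0"
        using C(4) that by auto
      then have "\<bar>a c\<bar> * norm c \<le> M"
        using * by simp
      then show ?thesis
        using \<open>norm c > 0\<close> by (simp add: pos_le_divide_eq)
    qed
    then show "x \<in> ?D"
      using a by blast
  qed
  moreover have "?D \<subseteq> span B"
    unfolding C(2)[symmetric] by (auto intro!: span_sum span_scale intro: span_base)
  ultimately have "span B \<inter> S = ?D \<inter> S"
    by blast
  then show ?thesis
    using compact_Int_closed[OF compact_coefficient_box[OF C(1)] assms(2)] by simp
qed

lemma bounded_linear_dual_embed: "bounded_linear (dual_embed j)"
  unfolding dual_embed_def
  by (intro bounded_linear_compose[OF bounded_bilinear.bounded_linear_left[OF bounded_bilinear_blinfun_compose]] bounded_linear_blinfun_inner_left)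

lemma dual_embed_apply [simp]: "dual_embed j y v = y \<bullet> j v"
  by (simp add: dual_embed_def inner_commute)

text \<open>
  The distance from \<open>y\<close> to the sum set is attained, because it is a continuous convex function on a
  closed bounded convex subset of the product Hilbert space. Hence no separate proof is needed that
  the sum of the two sets is closed. The separating direction comes from the nearest point.
\<close>

lemma separate_from_sum:
  fixes j :: "'v::{real_inner,complete_space} \<Rightarrow>\<^sub>L 'h::{real_inner,complete_space}"
  assumes A: "A \<in> CBC" and B: "B \<in> CBC"
    and notin: "\<And>y\<^sub>V y\<^sub>H. y\<^sub>V \<in> A \<Longrightarrow> y\<^sub>H \<in> B \<Longrightarrow> y \<noteq> y\<^sub>V + dual_embed j y\<^sub>H"
  obtains v \<delta> where "\<delta> > 0"
    "\<And>y\<^sub>V y\<^sub>H. y\<^sub>V \<in> A \<Longrightarrow> y\<^sub>H \<in> B \<Longrightarrow> (y\<^sub>V + dual_embed j y\<^sub>H - y) v \<le> - \<delta>"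
proof -
  interpret de: bounded_linear "dual_embed j"
    by (rule bounded_linear_dual_embed)
  interpret il: bounded_linear "blinfun_inner_left :: 'v \<Rightarrow> _"
    by (rule bounded_linear_blinfun_inner_left)
  define S where "S = {p. blinfun_inner_left (fst p) \<in> A \<and> snd p \<in> B}"
  define L where "L p = blinfun_inner_left (fst p) + dual_embed j (snd p) - y" for p
  have AB: "A \<noteq> {}" "closed A" "bounded A" "convex A" "B \<noteq> {}" "closed B" "bounded B" "convex B"
    using A B by (auto simp: CBC_def)
  have L_aff: "L (u *\<^sub>R p + v *\<^sub>R q) = u *\<^sub>R L p + v *\<^sub>R L q" if "u + v = 1" for u v p q
  proof -
    have "- (u *\<^sub>R y) - v *\<^sub>R y = - ((u + v) *\<^sub>R y)"
      by (simp add: scaleR_add_left)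
    then have "- (u *\<^sub>R y) - v *\<^sub>R y = - y"
      using that by simp
    then show ?thesis
      unfolding L_def
      by (simp add: il.add il.scaleR de.add de.scaleR scaleR_add_right scaleR_diff_right)
  qed
  have contL: "continuous_on UNIV L"
    unfolding L_def by (intro continuous_intros il.continuous_on de.continuous_on)
  have cvS: "convex S"
    using AB convexD[of A] convexD[of B]
    by (intro convexI) (auto simp: S_def il.add il.scaleR)
  have clS: "closed S"
  proof -
    have "S = (\<lambda>p. blinfun_inner_left (fst p)) -` A \<inter> snd -` B"
      by (auto simp: S_def)
    then show ?thesis
      using AB by (auto intro!: closed_Int closed_vimage continuous_intros il.continuous_on)
  qed
  have bdS: "bounded S"
  proof -
    obtain a c where "\<And>x. x \<in> A \<Longrightarrow> norm x \<le> a" "\<And>x. x \<in> B \<Longrightarrow> norm x \<le> c"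
      using AB by (auto simp: bounded_iff)
    then have "S \<subseteq> cball 0 a \<times> cball 0 c"
      unfolding S_def by force
    then show ?thesis
      using bounded_Times[OF bounded_cball bounded_cball] bounded_subset by blast
  qed
  obtain z where z: "z \<in> S" "\<And>p. p \<in> S \<Longrightarrow> norm (L z) \<le> norm (L p)"
  proof (rule quasiconvex_attains_inf[of S 0 "\<lambda>p. norm (L p)"])
    obtain a c where "a \<in> A" "c \<in> B"
      using AB by blast
    moreover obtain w where "a = blinfun_inner_left w"
      by (rule blinfun_as_inner)
    ultimately have "(w, c) \<in> S"
      by (simp add: S_def)
    then show "S \<noteq> {}"
      by blast
  next
    fix r
    have eq: "{p \<in> S. norm (L p) \<le> r} = S \<inter> {p. norm (L p) \<le> r}"
      by blast
    show "closed {p \<in> S. norm (L p) \<le> r}"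
      unfolding eq by (intro closed_Int clS closed_Collect_le continuous_intros contL)
    show "bounded {p \<in> S. norm (L p) \<le> r}"
      unfolding eq using bdS by (simp add: bounded_Int)
    show "convex {p \<in> S. norm (L p) \<le> r}"
      unfolding eq
    proof (intro convex_Int cvS convexI, clarsimp)
      fix a c d e u v assume *: "norm (L (a, c)) \<le> r" "norm (L (d, e)) \<le> r" "0 \<le> u" "0 \<le> v" "u + v = (1::real)"
      have "norm (L (u *\<^sub>R (a, c) + v *\<^sub>R (d, e))) \<le> u * norm (L (a, c)) + v * norm (L (d, e))"
        unfolding L_aff[OF *(5)] using norm_triangle_ineq[of "u *\<^sub>R L (a, c)" "v *\<^sub>R L (d, e)"] * by simp
      also have "\<dots> \<le> u * r + v * r"
        using * by (intro add_mono mult_left_mono) auto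
      finally show "norm (L (u *\<^sub>R a + v *\<^sub>R d, u *\<^sub>R c + v *\<^sub>R e)) \<le> r"
        using * by (simp flip: distrib_right)
    qed
  qed auto
  obtain u where u: "L z = blinfun_inner_left u"
    by (rule blinfun_as_inner)
  have "L z \<noteq> 0"
    using z(1) notin[of "blinfun_inner_left (fst z)" "snd z"] by (auto simp: S_def L_def)
  then have "u \<noteq> 0"
    using u by auto
  have key: "(norm u)\<^sup>2 \<le> L p u" if p: "p \<in> S" for p
  proof -
    obtain u' where u': "L p = blinfun_inner_left u'"
      by (rule blinfun_as_inner)
    have "\<not> inner (0 - u) (u' - u) > 0"
    proof
      assume "inner (0 - u) (u' - u) > 0"
      then obtain t where t: "t > 0" "t \<le> 1" "dist (u + t *\<^sub>R (u' - u)) 0 < dist u 0"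
        using closer_point_lemma by blast
      let ?q = "(1 - t) *\<^sub>R z + t *\<^sub>R p"
      have "?q \<in> S"
        using convexD_alt[OF cvS z(1) p, of t] t by simp
      moreover have "L ?q = blinfun_inner_left (u + t *\<^sub>R (u' - u))"
        using L_aff[of "1 - t" t z p]
        by (simp add: u u' il.add il.diff il.scaleR algebra_simps)
      ultimately show False
        using z(2)[of ?q] t(3) u by simp
    qed
    then show ?thesis
      by (simp add: u' inner_simps power2_norm_eq_inner)
  qed
  show ?thesis
  proof (rule that[of "(norm u)\<^sup>2" "- u"])
    fix y\<^sub>V y\<^sub>H assume *: "y\<^sub>V \<in> A" "y\<^sub>H \<in> B"
    obtain w where "y\<^sub>V = blinfun_inner_left w"
      by (rule blinfun_as_inner)
    then show "(y\<^sub>V + dual_embed j y\<^sub>H - y) (- u) \<le> - (norm u)\<^sup>2"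
      using key[of "(w, y\<^sub>H)"] * by (simp add: S_def L_def blinfun.minus_right)
  qed (use \<open>u \<noteq> 0\<close> in simp)
qed

lemma c_uhc_eventually_le:
  assumes F: "c_uhc p M F" and xs: "\<And>k. xs k \<in> M" "x \<in> M" "weakly_tendsto xs x"
    and le: "\<And>y. y \<in> F x \<Longrightarrow> p y v \<le> c" and "c < c'"
  shows "\<forall>\<^sub>F k in sequentially. \<forall>y\<in>F (xs k). p y v \<le> c'"
proof -
  have "limsup (\<lambda>k. SUP y\<in>F (xs k). ereal (p y v)) \<le> (SUP y\<in>F x. ereal (p y v))"
    using F xs unfolding c_uhc_def by blast
  also have "\<dots> \<le> ereal c"
    using le by (intro SUP_least) simp
  also have "\<dots> < ereal c'"
    using \<open>c < c'\<close> by simp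
  finally have "\<forall>\<^sub>F k in sequentially. (SUP y\<in>F (xs k). ereal (p y v)) < ereal c'"
    by (rule Limsup_lessD)
  then show ?thesis
    by eventually_elim (metis SUP_upper ereal_less_eq(3) less_imp_le order_trans)
qed

section \<open>Galerkin approximation\<close>

text \<open>
  The support function of \<open>A\<close> at \<open>v\<close> is less than \<open>c\<close>. This form needs no supremum, and it is true
  for \<open>A = {}\<close>.
\<close>

definition strictly_below ::
    "('v::real_normed_vector \<Rightarrow>\<^sub>L real) set \<Rightarrow> 'v \<Rightarrow> real \<Rightarrow> bool" where
  "strictly_below A v c \<longleftrightarrow> (\<exists>c'<c. \<forall>\<phi>\<in>A. \<phi> v \<le> c')"

lemma strictly_below_combine:
  assumes "strictly_below A v1 c1" "strictly_below A v2 c2" "u1 \<ge> 0" "u2 \<ge> 0" "u1 + u2 = 1"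
  shows "strictly_below A (u1 *\<^sub>R v1 + u2 *\<^sub>R v2) (u1 * c1 + u2 * c2)"
proof -
  obtain d1 d2 where d: "d1 < c1" "\<forall>\<phi>\<in>A. \<phi> v1 \<le> d1" "d2 < c2" "\<forall>\<phi>\<in>A. \<phi> v2 \<le> d2"
    using assms by (auto simp: strictly_below_def)
  have "u1 * d1 + u2 * d2 < u1 * c1 + u2 * c2"
  proof (cases "u1 = 0")
    case False
    then show ?thesis
      using d assms by (intro add_less_le_mono mult_strict_left_mono mult_left_mono) auto
  qed (use d assms in auto)
  moreover have "\<phi> (u1 *\<^sub>R v1 + u2 *\<^sub>R v2) \<le> u1 * d1 + u2 * d2" if "\<phi> \<in> A" for \<phi>
    using d assms that by (simp add: blinfun.add_right blinfun.scaleR_right add_mono mult_left_mono)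
  ultimately show ?thesis
    unfolding strictly_below_def by blast
qed

lemma strictly_below_scaleR:
  assumes "strictly_below A v 0" "u > 0"
  shows "strictly_below A (u *\<^sub>R v) 0"
proof -
  obtain d where d: "d < 0" "\<forall>\<phi>\<in>A. \<phi> v \<le> d"
    using assms by (auto simp: strictly_below_def)
  then show ?thesis
    using assms(2) unfolding strictly_below_def
    by (intro exI[of _ "u * d"]) (auto simp: blinfun.scaleR_right mult_pos_neg)
qed

text \<open>
  The inclusion \<open>0 \<in> G x\<close> on the ball \<open>M\<close>, where \<open>b\<close> takes the role of \<open>W_inner\<close> and \<open>G\<close> that of
  \<open>F - yb\<close>. Upper hemicontinuity is stated as the weak sequential openness of the sets
  \<open>{x. strictly_below (G x) v c}\<close>.
\<close>

locale coercive_inclusion = coercive_bilinear b \<alpha>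
  for b :: "'v::{real_inner,complete_space} \<Rightarrow> 'v \<Rightarrow> real" and \<alpha> +
  fixes G :: "'v \<Rightarrow> ('v \<Rightarrow>\<^sub>L real) set" and xt w :: 'v and R B :: real and M :: "'v set"
  assumes R_pos: "R > 0"
    and w_le: "b w w \<le> R\<^sup>2"
    and M_def: "M = {x. b (x - xt) (x - xt) \<le> R\<^sup>2}"
    and norm_le: "x \<in> M \<Longrightarrow> \<phi> \<in> G x \<Longrightarrow> norm \<phi> \<le> B"
    and usc: "(\<And>k. xs k \<in> M) \<Longrightarrow> x \<in> M \<Longrightarrow> weakly_tendsto xs x \<Longrightarrow> strictly_below (G x) v c \<Longrightarrow>
      \<forall>\<^sub>F k in sequentially. strictly_below (G (xs k)) v c"
    and inward: "x \<in> M \<Longrightarrow> \<exists>\<phi>\<in>G x. \<phi> (x - xt) \<le> - b (x - xt + w) (x - xt)"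
begin

text \<open>
  Uniform boundedness of the values of \<open>G\<close> extends upper hemicontinuity to directions that vary with
  the sequence, if they converge in norm.
\<close>

lemma strictly_below_eventually:
  assumes xs: "\<And>k. xs k \<in> M" "x \<in> M" "weakly_tendsto xs x"
    and vs: "vs \<longlonglongrightarrow> v" and cs: "cs \<longlonglongrightarrow> c" and below: "strictly_below (G x) v c"
  shows "\<forall>\<^sub>F k in sequentially. strictly_below (G (xs k)) (vs k) (cs k)"
proof -
  obtain c' where c': "c' < c" "\<forall>\<phi>\<in>G x. \<phi> v \<le> c'"
    using below by (auto simp: strictly_below_def)
  define r where "r = (c - c') / 4"
  have "r > 0"
    using c' by (simp add: r_def)
  have "strictly_below (G x) v (c' + r)"
    using c' \<open>r > 0\<close> by (auto simp: strictly_below_def intro!: exI[of _ c'])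
  from usc[OF xs this] have 1: "\<forall>\<^sub>F k in sequentially. strictly_below (G (xs k)) v (c' + r)" .
  have "(\<lambda>k. \<bar>B\<bar> * norm (vs k - v)) \<longlonglongrightarrow> \<bar>B\<bar> * norm (v - v)"
    by (intro tendsto_intros vs)
  then have 2: "\<forall>\<^sub>F k in sequentially. \<bar>B\<bar> * norm (vs k - v) < r"
    using \<open>r > 0\<close> by (intro order_tendstoD(2)) auto
  have 3: "\<forall>\<^sub>F k in sequentially. c - r < cs k"
    using cs \<open>r > 0\<close> by (intro order_tendstoD(1)) auto
  show ?thesis
    using 1 2 3
  proof eventually_elim
    case (elim k)
    have "\<phi> (vs k) \<le> c' + 2 * r" if "\<phi> \<in> G (xs k)" for \<phi>
    proof -
      have "\<phi> v \<le> c' + r"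
        using elim(1) that by (auto simp: strictly_below_def)
      moreover have "\<phi> (vs k - v) \<le> \<bar>B\<bar> * norm (vs k - v)"
      proof -
        have "\<phi> (vs k - v) \<le> norm \<phi> * norm (vs k - v)"
          using norm_blinfun[of \<phi> "vs k - v"] by (simp add: abs_le_iff)
        also have "\<dots> \<le> \<bar>B\<bar> * norm (vs k - v)"
          using norm_le[OF xs(1) that] by (intro mult_right_mono) auto
        finally show ?thesis .
      qed
      moreover have "\<phi> (vs k) = \<phi> v + \<phi> (vs k - v)"
        by (simp add: blinfun.diff_right)
      ultimately show ?thesis
        using elim(2) by linarith
    qed
    moreover have "c' + 2 * r < cs k"
      using elim(3) \<open>r > 0\<close> unfolding r_def by argo
    ultimately show ?case
      unfolding strictly_below_def by blast
  qed
qed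

lemma ball_absorbing:
  assumes "b y y < R\<^sup>2"
  obtains r where "r > 0" "b (y - r *\<^sub>R v) (y - r *\<^sub>R v) \<le> R\<^sup>2"
proof -
  have "((\<lambda>r. b (y - r *\<^sub>R v) (y - r *\<^sub>R v)) \<longlongrightarrow> b (y - 0 *\<^sub>R v) (y - 0 *\<^sub>R v)) (at_right 0)"
    by (intro tendsto tendsto_intros)
  then have "\<forall>\<^sub>F r in at_right 0. b (y - r *\<^sub>R v) (y - r *\<^sub>R v) < R\<^sup>2"
    using assms by (intro order_tendstoD(2)) auto
  moreover have "\<forall>\<^sub>F r in at_right (0::real). r > 0"
    by (rule eventually_at_right_less)
  ultimately have "\<forall>\<^sub>F r in at_right 0. r > 0 \<and> b (y - r *\<^sub>R v) (y - r *\<^sub>R v) \<le> R\<^sup>2"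
    by eventually_elim auto
  then show ?thesis
    using that eventually_happens' trivial_limit_at_right_real by blast
qed

text \<open>
  The set \<open>{d. b (d + w) d \<le> 0}\<close> is the ball of centre \<open>- w / 2\<close> with \<open>0\<close> and \<open>- w\<close> as antipodal
  points. The next two lemmas locate it inside the ball of radius \<open>R\<close> around \<open>0\<close>, which it can touch
  only at \<open>- w\<close>.
\<close>

lemma square_distance:
  assumes "b (d + w) d \<le> 0"
  shows "b (d + w) (d + w) \<le> b w w - b d d"
  using assms by (simp add: add_left add_right sym[of w d])

lemma small_ball_subset:
  assumes "b (d + w) d \<le> 0"
  shows "b d d \<le> R\<^sup>2"
  using square_distance[OF assms] nonneg[of "d + w"] w_le by linarith

text \<open>
  If \<open>v\<close> is penalised at \<open>d\<close>, then \<open>\<phi> v < 0\<close> for every member \<open>\<phi>\<close> of the truncated value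
  \<open>{\<phi> \<in> G (xt + d). \<phi> d \<le> - b (d + w) d}\<close>. The number \<open>\<mu>\<close> is the Lagrange multiplier of the
  truncation. For a fixed \<open>\<mu>\<close> the condition is open with respect to \<open>d\<close> and \<open>v\<close>, and convex
  combinations of penalised directions are penalised.
\<close>

definition penalised :: "'v \<Rightarrow> 'v \<Rightarrow> bool" where
  "penalised d v \<longleftrightarrow> (\<exists>\<mu>\<ge>0. strictly_below (G (xt + d)) (v - \<mu> *\<^sub>R d) (\<mu> * b (d + w) d))"

lemma not_penalised_zero:
  assumes "b d d \<le> R\<^sup>2"
  shows "\<not> penalised d 0"
proof
  assume "penalised d 0"
  then obtain \<mu> c' where \<mu>: "\<mu> \<ge> 0" "c' < \<mu> * b (d + w) d" "\<forall>\<phi>\<in>G (xt + d). \<phi> (0 - \<mu> *\<^sub>R d) \<le> c'"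
    unfolding penalised_def strictly_below_def by blast
  have "xt + d \<in> M"
    using assms by (simp add: M_def)
  from inward[OF this] obtain \<phi> where \<phi>: "\<phi> \<in> G (xt + d)" "\<phi> d \<le> - b (d + w) d"
    by auto
  have "- (\<mu> * \<phi> d) \<le> c'"
    using \<mu>(3) \<phi>(1) by (auto simp: blinfun.scaleR_right blinfun.minus_right)
  moreover have "\<mu> * \<phi> d \<le> \<mu> * - b (d + w) d"
    using \<mu>(1) \<phi>(2) by (rule mult_left_mono[rotated])
  ultimately show False
    using \<mu>(2) by simp
qed

lemma convex_penalised: "convex {z. penalised d (d - z)}"
proof (rule convexI, unfold mem_Collect_eq)
  fix x y u v assume *: "penalised d (d - x)" "penalised d (d - y)" "0 \<le> u" "0 \<le> v" "u + v = (1::real)"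
  obtain \<mu> \<nu> where \<mu>: "\<mu> \<ge> 0" "strictly_below (G (xt + d)) (d - x - \<mu> *\<^sub>R d) (\<mu> * b (d + w) d)"
    and \<nu>: "\<nu> \<ge> 0" "strictly_below (G (xt + d)) (d - y - \<nu> *\<^sub>R d) (\<nu> * b (d + w) d)"
    using *(1,2) unfolding penalised_def by blast
  have d: "d = u *\<^sub>R d + v *\<^sub>R d"
    using *(5) by (simp flip: scaleR_add_left)
  have "u *\<^sub>R (d - x - \<mu> *\<^sub>R d) + v *\<^sub>R (d - y - \<nu> *\<^sub>R d)
      = (u *\<^sub>R d + v *\<^sub>R d) - (u *\<^sub>R x + v *\<^sub>R y) - (u * \<mu> + v * \<nu>) *\<^sub>R d"
    by (simp add: algebra_simps)
  also have "\<dots> = d - (u *\<^sub>R x + v *\<^sub>R y) - (u * \<mu> + v * \<nu>) *\<^sub>R d"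
    using d by simp
  finally have "strictly_below (G (xt + d)) (d - (u *\<^sub>R x + v *\<^sub>R y) - (u * \<mu> + v * \<nu>) *\<^sub>R d)
      ((u * \<mu> + v * \<nu>) * b (d + w) d)"
    using strictly_below_combine[OF \<mu>(2) \<nu>(2) *(3-5)] by (simp add: algebra_simps)
  then show "penalised d (d - (u *\<^sub>R x + v *\<^sub>R y))"
    unfolding penalised_def using *(3,4) \<mu>(1) \<nu>(1) by (intro exI[of _ "u * \<mu> + v * \<nu>"]) simp
qed

lemma closed_not_penalised: "closed {d. b d d \<le> R\<^sup>2 \<and> \<not> penalised d (d - z)}"
  unfolding closed_sequential_limits
proof (intro allI impI, elim conjE)
  fix ds d assume ds: "\<forall>k. ds k \<in> {d. b d d \<le> R\<^sup>2 \<and> \<not> penalised d (d - z)}" "ds \<longlonglongrightarrow> d"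
  have "closed {d. b d d \<le> R\<^sup>2}"
    by (intro closed_Collect_le continuous_quadratic continuous_intros)
  then have d: "b d d \<le> R\<^sup>2"
    using ds by (auto simp: closed_sequential_limits)
  have "\<not> penalised d (d - z)"
  proof
    assume "penalised d (d - z)"
    then obtain \<mu> where \<mu>: "\<mu> \<ge> 0" "strictly_below (G (xt + d)) (d - z - \<mu> *\<^sub>R d) (\<mu> * b (d + w) d)"
      unfolding penalised_def by blast
    have "\<forall>\<^sub>F k in sequentially. strictly_below (G (xt + ds k)) (ds k - z - \<mu> *\<^sub>R ds k) (\<mu> * b (ds k + w) (ds k))"
    proof (rule strictly_below_eventually[OF _ _ _ _ _ \<mu>(2)])
      show "xt + ds k \<in> M" for k
        using ds(1) by (simp add: M_def)
      show "xt + d \<in> M"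
        using d by (simp add: M_def)
      show "weakly_tendsto (\<lambda>k. xt + ds k) (xt + d)"
        by (intro tendsto_imp_weakly_tendsto tendsto_intros ds)
      show "(\<lambda>k. ds k - z - \<mu> *\<^sub>R ds k) \<longlonglongrightarrow> d - z - \<mu> *\<^sub>R d"
        by (intro tendsto_intros ds)
      show "(\<lambda>k. \<mu> * b (ds k + w) (ds k)) \<longlonglongrightarrow> \<mu> * b (d + w) d"
        by (intro tendsto tendsto_intros ds)
    qed
    then obtain k where "strictly_below (G (xt + ds k)) (ds k - z - \<mu> *\<^sub>R ds k) (\<mu> * b (ds k + w) (ds k))"
      using eventually_happens' sequentially_bot by blast
    then have "penalised (ds k) (ds k - z)"
      unfolding penalised_def using \<mu>(1) by blast
    then show False
      using ds(1) by blast
  qed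
  then show "d \<in> {d. b d d \<le> R\<^sup>2 \<and> \<not> penalised d (d - z)}"
    using d by blast
qed

lemma bounded_ball: "bounded {d. b d d \<le> r}"
proof (rule boundedI)
  fix d assume "d \<in> {d. b d d \<le> r}"
  then have "(norm d)\<^sup>2 \<le> r / \<alpha>"
    using coercive[of d] \<alpha>_pos by (simp add: pos_le_divide_eq mult.commute)
  then show "norm d \<le> sqrt (r / \<alpha>)"
    by (rule real_le_rsqrt)
qed

lemma galerkin:
  assumes "finite E"
  obtains d where "b (d + w) d \<le> 0" "\<And>v. v \<in> span E \<Longrightarrow> \<not> strictly_below (G (xt + d)) v 0"
proof -
  define K where "K = span E \<inter> {d. b d d \<le> R\<^sup>2}"
  have "compact K"
    unfolding K_def
    by (intro compact_span_Int assms bounded_ball closed_Collect_le continuous_quadratic continuous_intros)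
  have cvB: "convex {d. b d d \<le> R\<^sup>2}"
  proof (rule convexI, unfold mem_Collect_eq)
    fix x y u v assume *: "b x x \<le> R\<^sup>2" "b y y \<le> R\<^sup>2" "0 \<le> u" "0 \<le> v" "u + v = (1::real)"
    have "b (u *\<^sub>R x + v *\<^sub>R y) (u *\<^sub>R x + v *\<^sub>R y) \<le> u * R\<^sup>2 + v * R\<^sup>2"
      using quadratic_convex[OF *(5,3,4), of x y] * by (meson add_mono mult_left_mono order_trans)
    then show "b (u *\<^sub>R x + v *\<^sub>R y) (u *\<^sub>R x + v *\<^sub>R y) \<le> R\<^sup>2"
      using *(5) by (simp flip: distrib_right)
  qed
  then have "convex K"
    unfolding K_def by (rule convex_Int[OF subspace_imp_convex[OF subspace_span]])
  have "0 \<in> K"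
    by (simp add: K_def span_zero zero_left)
  obtain d where d: "d \<in> K" "\<And>z. z \<in> K \<Longrightarrow> d \<in> {d. b d d \<le> R\<^sup>2 \<and> \<not> penalised d (d - z)}"
  proof (rule kkm_compact[of K "\<lambda>z. {d. b d d \<le> R\<^sup>2 \<and> \<not> penalised d (d - z)}"])
    fix J assume J: "finite J" "J \<subseteq> K"
    show "convex hull J \<subseteq> (\<Union>z\<in>J. {d. b d d \<le> R\<^sup>2 \<and> \<not> penalised d (d - z)})"
    proof
      fix d assume d: "d \<in> convex hull J"
      have "convex hull J \<subseteq> K"
        using J \<open>convex K\<close> by (simp add: hull_minimal)
      then have bd: "b d d \<le> R\<^sup>2"
        using d by (auto simp: K_def)
      have "\<exists>z\<in>J. \<not> penalised d (d - z)"
      proof (rule ccontr)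
        assume "\<not> (\<exists>z\<in>J. \<not> penalised d (d - z))"
        then have "convex hull J \<subseteq> {z. penalised d (d - z)}"
          by (intro hull_minimal convex_penalised) auto
        then show False
          using d not_penalised_zero[OF bd] by auto
      qed
      then show "d \<in> (\<Union>z\<in>J. {d. b d d \<le> R\<^sup>2 \<and> \<not> penalised d (d - z)})"
        using bd by blast
    qed
  qed (use \<open>compact K\<close> \<open>convex K\<close> \<open>0 \<in> K\<close> closed_not_penalised in blast)+
  have dR: "b d d \<le> R\<^sup>2" and dE: "d \<in> span E"
    using d(1) by (auto simp: K_def)
  have np: "\<not> penalised d (d - z)" if "z \<in> K" for z
    using d(2)[OF that] by blast
  \<comment> \<open>Outside the small ball, \<open>\<mu> = 1\<close> shows that \<open>d - z\<close> is penalised for \<open>z = 0\<close>.\<close>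
  have small: "b (d + w) d \<le> 0"
  proof (rule ccontr)
    assume "\<not> b (d + w) d \<le> 0"
    then have "strictly_below (G (xt + d)) (d - 0 - 1 *\<^sub>R d) (1 * b (d + w) d)"
      by (auto simp: strictly_below_def intro!: exI[of _ 0])
    then have "penalised d (d - 0)"
      unfolding penalised_def using zero_le_one by blast
    then show False
      using np[OF \<open>0 \<in> K\<close>] by blast
  qed
  moreover have "\<not> strictly_below (G (xt + d)) v 0" if v: "v \<in> span E" for v
  proof
    assume neg: "strictly_below (G (xt + d)) v 0"
    show False
    proof (cases "b d d < R\<^sup>2")
      case True
      then obtain r where r: "r > 0" "b (d - r *\<^sub>R v) (d - r *\<^sub>R v) \<le> R\<^sup>2"
        by (rule ball_absorbing)
      have "d - r *\<^sub>R v \<in> K"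
        using r dE v by (simp add: K_def span_diff span_scale)
      moreover have "penalised d (d - (d - r *\<^sub>R v))"
        unfolding penalised_def using strictly_below_scaleR[OF neg r(1)] by (intro exI[of _ 0]) simp
      ultimately show False
        using np by blast
    next
      case False
      then have "b (d + w) (d + w) \<le> 0"
        using square_distance[OF small] w_le by linarith
      then have dw: "d + w = 0"
        by (rule eq_zero)
      obtain r where r: "r > 0" "b (0 - r *\<^sub>R v) (0 - r *\<^sub>R v) \<le> R\<^sup>2"
        by (rule ball_absorbing[of 0 v]) (use R_pos in \<open>auto simp: zero_left\<close>)
      \<comment> \<open>Here \<open>d = - w\<close> is on the boundary of the large ball, so that \<open>d - r *\<^sub>R v\<close> may be outside.
        For \<open>z\<close> equal to \<open>d / 2\<close> up to a multiple of \<open>v\<close>, the multiplier \<open>\<mu> = 1/2\<close> removes \<open>d / 2\<close> from \<open>d - z\<close>, at no cost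
        because \<open>b (d + w) d = 0\<close>.\<close>
      define z where "z = (1/2) *\<^sub>R d + (1/2) *\<^sub>R (0 - r *\<^sub>R v)"
      have "z \<in> {d. b d d \<le> R\<^sup>2}"
        unfolding z_def using convexD[OF cvB, of d "0 - r *\<^sub>R v" "1/2" "1/2"] dR r by simp
      moreover have "z \<in> span E"
        unfolding z_def by (intro span_add span_scale span_diff span_zero dE v)
      ultimately have "z \<in> K"
        by (simp add: K_def)
      have "d - z - (1/2) *\<^sub>R d = (r/2) *\<^sub>R v"
      proof -
        have "d - z - (1/2) *\<^sub>R d = (1 - 1/2 - 1/2) *\<^sub>R d + (r/2) *\<^sub>R v"
          unfolding z_def scaleR_diff_left by (simp add: algebra_simps)
        then show ?thesis
          by simp
      qed
      then have "strictly_below (G (xt + d)) (d - z - (1/2) *\<^sub>R d) ((1/2) * b (d + w) d)"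
        using strictly_below_scaleR[OF neg, of "r/2"] r by (simp add: dw zero_left)
      then have "penalised d (d - z)"
        unfolding penalised_def by (intro exI[of _ "1/2"]) simp
      then show False
        using np[OF \<open>z \<in> K\<close>] by blast
    qed
  qed
  ultimately show ?thesis
    by (rule that)
qed

lemma exists_weak_zero:
  assumes dense: "closure (range (e :: nat \<Rightarrow> 'v)) = UNIV"
  obtains d where "b (d + w) d \<le> 0" "\<And>v. \<not> strictly_below (G (xt + d)) v 0"
proof -
  have "\<forall>n. \<exists>d. b (d + w) d \<le> 0 \<and> (\<forall>v\<in>span (e ` {..n}). \<not> strictly_below (G (xt + d)) v 0)"
    using galerkin by (metis finite_atMost finite_imageI)
  then obtain ds where ds: "\<And>n. b (ds n + w) (ds n) \<le> 0"
    "\<And>n v. v \<in> span (e ` {..n}) \<Longrightarrow> \<not> strictly_below (G (xt + ds n)) v 0"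
    unfolding choice_iff by blast
  obtain D where D: "\<And>d. b d d \<le> R\<^sup>2 \<Longrightarrow> norm d \<le> D"
    using bounded_ball[of "R\<^sup>2"] by (auto simp: bounded_iff)
  obtain d \<sigma> where \<sigma>: "strict_mono \<sigma>" and lim: "weakly_tendsto (\<lambda>k. ds (\<sigma> k)) d"
  proof (rule bounded_has_weakly_convergent_subseq[of ds D e])
    show "norm (ds k) \<le> D" for k
      using D small_ball_subset[OF ds(1)] .
  qed (use dense in auto)
  have limb: "(\<lambda>k. b y (ds (\<sigma> k))) \<longlonglongrightarrow> b y d" for y
    using lim bounded_linear_right[of y] unfolding weakly_tendsto_def
    by (auto dest!: spec[of _ "Blinfun (b y)"] simp: bounded_linear_Blinfun_apply)
  have small: "b (d + w) d \<le> 0"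
  proof -
    \<comment> \<open>The quadratic form is bounded from below by its tangent at the weak limit.\<close>
    have "(\<lambda>k. 2 * b d (ds (\<sigma> k)) - b d d + b w (ds (\<sigma> k))) \<longlonglongrightarrow> 2 * b d d - b d d + b w d"
      by (intro tendsto_intros limb)
    moreover have "2 * b d (ds (\<sigma> k)) - b d d + b w (ds (\<sigma> k)) \<le> 0" for k
      using nonneg[of "ds (\<sigma> k) - d"] ds(1)[of "\<sigma> k"]
      by (simp add: add_left diff_left diff_right sym[of "ds (\<sigma> k)" d])
    ultimately have "2 * b d d - b d d + b w d \<le> 0"
      by (intro tendsto_upperbound) auto
    then show ?thesis
      by (simp add: add_left)
  qed
  have "\<not> strictly_below (G (xt + d)) v 0" for v
  proof
    assume v: "strictly_below (G (xt + d)) v 0"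
    have "v \<in> closure (range e)"
      using dense by simp
    then obtain i where i: "i \<longlonglongrightarrow> v" "\<And>k. i k \<in> range e"
      by (auto simp: closure_sequential)
    have M: "xt + d \<in> M" "xt + ds k \<in> M" for k
      using small_ball_subset small ds(1) by (auto simp: M_def)
    have "\<forall>\<^sub>F k in sequentially. strictly_below (G (xt + d)) (i k) 0"
      by (rule strictly_below_eventually[OF _ _ _ i(1) tendsto_const v])
         (auto simp: M weakly_tendsto_def)
    then obtain k where "strictly_below (G (xt + d)) (i k) 0"
      using eventually_happens' sequentially_bot by blast
    then obtain m where m: "strictly_below (G (xt + d)) (e m) 0"
      using i(2)[of k] by auto
    have "weakly_tendsto (\<lambda>k. xt + ds (\<sigma> k)) (xt + d)"
      using lim unfolding weakly_tendsto_def blinfun.add_right by (auto intro: tendsto_add)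
    from usc[OF _ M(1) this m] M(2)
    have "\<forall>\<^sub>F k in sequentially. strictly_below (G (xt + ds (\<sigma> k))) (e m) 0"
      by simp
    with eventually_ge_at_top[of m]
    have "\<forall>\<^sub>F k in sequentially. False"
    proof eventually_elim
      case (elim k)
      have "m \<le> \<sigma> k"
        using elim(1) seq_suble[OF \<sigma>, of k] by simp
      then have "e m \<in> span (e ` {..\<sigma> k})"
        by (intro span_base) simp
      then show False
        using ds(2) elim(2) by blast
    qed
    then show False
      by simp
  qed
  with small show ?thesis
    by (rule that)
qed

end

section \<open>The Gelfand triple\<close>

lemma W_dual_norm_eq:
  assumes "coercive_bilinear (W_inner j l\<^sub>V l\<^sub>H) \<alpha>"
    and w: "\<And>v. W_inner j l\<^sub>V l\<^sub>H w v = blinfun_apply \<phi> v"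
  shows "W_dual_norm j l\<^sub>V l\<^sub>H \<phi> = W_norm j l\<^sub>V l\<^sub>H w"
proof -
  interpret coercive_bilinear "W_inner j l\<^sub>V l\<^sub>H" \<alpha>
    by fact
  let ?S = "insert 0 {\<phi> x / W_norm j l\<^sub>V l\<^sub>H x | x. x \<noteq> 0}"
  have W_pos: "W_norm j l\<^sub>V l\<^sub>H x > 0" if "x \<noteq> 0" for x
    using pos[OF that] by (simp add: W_norm_def)
  have le: "s \<le> W_norm j l\<^sub>V l\<^sub>H w" if "s \<in> ?S" for s
  proof (cases "s = 0")
    case False
    then obtain x where x: "x \<noteq> 0" "s = \<phi> x / W_norm j l\<^sub>V l\<^sub>H x"
      using \<open>s \<in> ?S\<close> by auto
    have "\<phi> x \<le> W_norm j l\<^sub>V l\<^sub>H w * W_norm j l\<^sub>V l\<^sub>H x"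
      using cauchy_schwarz[of w x] by (simp add: W_norm_def w)
    then show ?thesis
      using W_pos[OF x(1)] by (simp add: x(2) pos_divide_le_eq)
  qed (simp add: W_norm_def nonneg)
  have "W_norm j l\<^sub>V l\<^sub>H w \<in> ?S"
  proof (cases "w = 0")
    case False
    have "\<phi> w / W_norm j l\<^sub>V l\<^sub>H w = W_norm j l\<^sub>V l\<^sub>H w"
      using nonneg[of w] by (simp add: W_norm_def real_div_sqrt flip: w)
    then show ?thesis
      using False by force
  qed (simp add: W_norm_def zero_left)
  then show ?thesis
    unfolding W_dual_norm_def using le by (intro cSup_eq_maximum) auto
qed

lemma coercive_W_inner:
  assumes "gelfand_triple j c" "l\<^sub>V < 0" "l\<^sub>H < - l\<^sub>V / c\<^sup>2"
  shows "coercive_bilinear (W_inner j l\<^sub>V l\<^sub>H) (- l\<^sub>V - max 0 l\<^sub>H * c\<^sup>2)"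
proof
  have c: "c > 0" "\<And>v. norm (j v) \<le> c * norm v"
    using assms(1) by (auto simp: gelfand_triple_def)
  show "\<exists>K. \<forall>x y. norm (W_inner j l\<^sub>V l\<^sub>H x y) \<le> norm x * norm y * K"
  proof (intro exI allI)
    fix x y
    have "\<bar>j x \<bullet> j y\<bar> \<le> norm (j x) * norm (j y)"
      by (rule Cauchy_Schwarz_ineq2)
    also have "\<dots> \<le> (c * norm x) * (c * norm y)"
      using c by (intro mult_mono) auto
    finally have 1: "\<bar>l\<^sub>H\<bar> * \<bar>j x \<bullet> j y\<bar> \<le> \<bar>l\<^sub>H\<bar> * ((c * norm x) * (c * norm y))"
      by (intro mult_left_mono) auto
    have 2: "\<bar>l\<^sub>V\<bar> * \<bar>x \<bullet> y\<bar> \<le> \<bar>l\<^sub>V\<bar> * (norm x * norm y)"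
      by (intro mult_left_mono Cauchy_Schwarz_ineq2) auto
    have "norm (W_inner j l\<^sub>V l\<^sub>H x y) \<le> \<bar>l\<^sub>V\<bar> * \<bar>x \<bullet> y\<bar> + \<bar>l\<^sub>H\<bar> * \<bar>j x \<bullet> j y\<bar>"
      unfolding W_inner_def real_norm_def abs_mult[symmetric] by linarith
    also have "\<dots> \<le> norm x * norm y * (\<bar>l\<^sub>V\<bar> + \<bar>l\<^sub>H\<bar> * (c * c))"
      using 1 2 by (simp add: algebra_simps)
    finally show "norm (W_inner j l\<^sub>V l\<^sub>H x y) \<le> norm x * norm y * (\<bar>l\<^sub>V\<bar> + \<bar>l\<^sub>H\<bar> * (c * c))" .
  qed
  have "l\<^sub>H * c\<^sup>2 < - l\<^sub>V"
    using assms(3) c(1) pos_less_divide_eq[of "c\<^sup>2" l\<^sub>H "- l\<^sub>V"] by simp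
  then show "0 < - l\<^sub>V - max 0 l\<^sub>H * c\<^sup>2"
    using assms(2) by (auto simp: max_def)
  fix x
  have "l\<^sub>H * (norm (j x))\<^sup>2 \<le> max 0 l\<^sub>H * (norm (j x))\<^sup>2"
    by (intro mult_right_mono) auto
  also have "\<dots> \<le> max 0 l\<^sub>H * (c * norm x)\<^sup>2"
    using c(2)[of x] by (intro mult_left_mono power_mono) auto
  finally show "(- l\<^sub>V - max 0 l\<^sub>H * c\<^sup>2) * (norm x)\<^sup>2 \<le> W_inner j l\<^sub>V l\<^sub>H x x"
    by (simp add: W_inner_def power_mult_distrib left_diff_distrib mult.assoc flip: power2_norm_eq_inner)
qed (auto simp: W_inner_def inner_simps inner_commute blinfun.add_right blinfun.scaleR_right algebra_simps)

lemma separable_obtains_dense_sequence: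
  assumes "separable_space (euclidean :: 'a::topological_space topology)"
  obtains e :: "nat \<Rightarrow> 'a::topological_space" where "closure (range e) = UNIV"
proof -
  obtain C :: "'a set" where C: "countable C" "closure C = UNIV"
    using assms by (auto simp: separable_space_def)
  then have "range (from_nat_into C) = C"
    by (intro range_from_nat_into) auto
  then show ?thesis
    using that C(2) by metis
qed

lemma sum_map_strictly_below_eventually:
  assumes ne: "F\<^sub>V x \<noteq> {}" "F\<^sub>H x \<noteq> {}"
    and uhc: "c_uhc blinfun_apply M F\<^sub>V" "c_uhc inner M F\<^sub>H"
    and xs: "\<And>k. xs k \<in> M" "x \<in> M" "weakly_tendsto xs x"
    and below: "strictly_below ((\<lambda>\<phi>. \<phi> - y) ` sum_map j F\<^sub>V F\<^sub>H x) v c"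
  shows "\<forall>\<^sub>F k in sequentially. strictly_below ((\<lambda>\<phi>. \<phi> - y) ` sum_map j F\<^sub>V F\<^sub>H (xs k)) v c"
proof -
  obtain c' where c': "c' < c" "\<And>\<phi> \<psi>. \<phi> \<in> F\<^sub>V x \<Longrightarrow> \<psi> \<in> F\<^sub>H x \<Longrightarrow> \<phi> v + \<psi> \<bullet> j v - y v \<le> c'"
    using below by (fastforce simp: strictly_below_def sum_map_def blinfun.add_left blinfun.diff_left)
  \<comment> \<open>Split the bound for the sum into one bound for each summand.\<close>
  define c\<^sub>V where "c\<^sub>V = (SUP \<phi>\<in>F\<^sub>V x. blinfun_apply \<phi> v)"
  define c\<^sub>H where "c\<^sub>H = c' + y v - c\<^sub>V"
  define r where "r = (c - c') / 4"
  have "r > 0"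
    using c'(1) by (simp add: r_def)
  have bdd: "bdd_above ((\<lambda>\<phi>. blinfun_apply \<phi> v) ` F\<^sub>V x)"
  proof -
    obtain \<psi> where "\<psi> \<in> F\<^sub>H x"
      using ne by blast
    then show ?thesis
      by (intro bdd_aboveI[of _ "c' + y v - \<psi> \<bullet> j v"]) (use c'(2) in force)
  qed
  have V: "\<phi> v \<le> c\<^sub>V" if "\<phi> \<in> F\<^sub>V x" for \<phi>
    unfolding c\<^sub>V_def by (rule cSUP_upper[OF that bdd])
  have H: "\<psi> \<bullet> j v \<le> c\<^sub>H" if "\<psi> \<in> F\<^sub>H x" for \<psi>
  proof -
    have "c\<^sub>V \<le> c' + y v - \<psi> \<bullet> j v"
      unfolding c\<^sub>V_def by (intro cSUP_least ne) (use c'(2) that in force)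
    then show ?thesis
      by (simp add: c\<^sub>H_def)
  qed
  have "\<forall>\<^sub>F k in sequentially. \<forall>\<phi>\<in>F\<^sub>V (xs k). \<phi> v \<le> c\<^sub>V + r"
    by (rule c_uhc_eventually_le[OF uhc(1) xs V]) (use \<open>r > 0\<close> in auto)
  moreover have "\<forall>\<^sub>F k in sequentially. \<forall>\<psi>\<in>F\<^sub>H (xs k). \<psi> \<bullet> j v \<le> c\<^sub>H + r"
    by (rule c_uhc_eventually_le[OF uhc(2) xs H]) (use \<open>r > 0\<close> in auto)
  ultimately show ?thesis
  proof eventually_elim
    case (elim k)
    have "\<phi> v + \<psi> \<bullet> j v - y v \<le> c' + 2 * r" if "\<phi> \<in> F\<^sub>V (xs k)" "\<psi> \<in> F\<^sub>H (xs k)" for \<phi> \<psi>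
      using elim(1)[rule_format, OF that(1)] elim(2)[rule_format, OF that(2)] unfolding c\<^sub>H_def by linarith
    moreover have "c' + 2 * r < c"
      using c'(1) unfolding r_def by argo
    ultimately show ?case
      by (auto simp: strictly_below_def sum_map_def blinfun.add_left blinfun.diff_left)
  qed
qed

lemma bounded_map_sum_map:
  assumes "bounded_map M F\<^sub>V" "bounded_map M F\<^sub>H"
  shows "bounded_map M (sum_map j F\<^sub>V F\<^sub>H)"
proof -
  have "bounded (dual_embed j ` (\<Union>x\<in>M. F\<^sub>H x))"
    using assms(2) bounded_linear_dual_embed unfolding bounded_map_def by (rule bounded_linear_image)
  then have "bounded ((\<lambda>(\<phi>, \<psi>). \<phi> + \<psi>) ` ((\<Union>x\<in>M. F\<^sub>V x) \<times> dual_embed j ` (\<Union>x\<in>M. F\<^sub>H x)))"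
    using assms(1) unfolding bounded_map_def by (intro bounded_plus)
  then show ?thesis
    unfolding bounded_map_def by (rule bounded_subset) (force simp: sum_map_def)
qed

theorem theorem11:
  fixes j :: "'v::{real_inner,complete_space} \<Rightarrow>\<^sub>L 'h::{real_inner,complete_space}"
    and c\<^sub>V\<^sub>H l\<^sub>V l\<^sub>H R :: real
    and xt x\<^sub>c :: 'v
    and yb yt yt\<^sub>V :: "'v \<Rightarrow>\<^sub>L real"
    and yt\<^sub>H :: 'h
    and F\<^sub>V :: "'v \<Rightarrow> ('v \<Rightarrow>\<^sub>L real) set"
    and F\<^sub>H :: "'v \<Rightarrow> 'h set"
    and F :: "'v \<Rightarrow> ('v \<Rightarrow>\<^sub>L real) set"
    and M :: "'v set"
  assumes "gelfand_triple j c\<^sub>V\<^sub>H"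
    and "l\<^sub>V < 0" and "l\<^sub>H < - l\<^sub>V / c\<^sub>V\<^sub>H\<^sup>2"
    and "R > 0"
    and "M = W_cball j l\<^sub>V l\<^sub>H xt R"
    and "\<forall>x\<in>M. F\<^sub>V x \<in> CBC" and "bounded_map M F\<^sub>V" and "c_uhc blinfun_apply M F\<^sub>V"
    and "\<forall>x\<in>M. F\<^sub>H x \<in> CBC" and "bounded_map M F\<^sub>H" and "c_uhc inner M F\<^sub>H"
    and "\<forall>x\<in>M. F x = sum_map j F\<^sub>V F\<^sub>H x"
    and "yt\<^sub>V \<in> F\<^sub>V xt" and "yt\<^sub>H \<in> F\<^sub>H xt" and "yt = yt\<^sub>V + dual_embed j yt\<^sub>H"
    and "W_dual_norm j l\<^sub>V l\<^sub>H (yb - yt) \<le> R"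
    and "\<forall>x\<in>M. \<exists>y\<^sub>V\<in>F\<^sub>V x. \<exists>y\<^sub>H\<in>F\<^sub>H x.
           (y\<^sub>V - yt\<^sub>V) (x - xt) \<le> l\<^sub>V * (norm (x - xt))\<^sup>2 \<and>
           (y\<^sub>H - yt\<^sub>H) \<bullet> j (x - xt) \<le> l\<^sub>H * (norm (j (x - xt)))\<^sup>2"
    and "x\<^sub>c = xt - (1 / 2) *\<^sub>R W_riesz j l\<^sub>V l\<^sub>H (yb - yt)"
  shows "\<exists>xb \<in> W_cball j l\<^sub>V l\<^sub>H x\<^sub>c (1 / 2 * W_dual_norm j l\<^sub>V l\<^sub>H (yt - yb)). yb \<in> F xb"
proof -
  let ?b = "W_inner j l\<^sub>V l\<^sub>H" and ?\<alpha> = "- l\<^sub>V - max 0 l\<^sub>H * c\<^sub>V\<^sub>H\<^sup>2"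
  have cb: "coercive_bilinear ?b ?\<alpha>"
    using assms(1-3) by (rule coercive_W_inner)
  interpret b: coercive_bilinear ?b ?\<alpha>
    by (rule cb)
  define w where "w = W_riesz j l\<^sub>V l\<^sub>H (yb - yt)"
  have w: "?b w v = (yb - yt) v" for v
    using theI'[OF b.riesz[of "yb - yt"]] unfolding w_def W_riesz_def by blast
  have norm_w: "W_dual_norm j l\<^sub>V l\<^sub>H (yb - yt) = W_norm j l\<^sub>V l\<^sub>H w"
    using cb w by (rule W_dual_norm_eq)
  have "?b (- w) v = (yt - yb) v" for v
    using w[of v] by (simp add: b.minus_left blinfun.diff_left)
  with cb have "W_dual_norm j l\<^sub>V l\<^sub>H (yt - yb) = W_norm j l\<^sub>V l\<^sub>H (- w)"
    by (rule W_dual_norm_eq)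
  then have norm_w': "W_dual_norm j l\<^sub>V l\<^sub>H (yt - yb) = sqrt (?b w w)"
    by (simp add: W_norm_def b.minus_left b.minus_right)
  define G where "G x = (\<lambda>\<phi>. \<phi> - yb) ` sum_map j F\<^sub>V F\<^sub>H x" for x
  have ne: "F\<^sub>V x \<noteq> {}" "F\<^sub>H x \<noteq> {}" if "x \<in> M" for x
    using assms(6,9) that by (auto simp: CBC_def)
  obtain B where B: "\<And>x \<phi>. x \<in> M \<Longrightarrow> \<phi> \<in> sum_map j F\<^sub>V F\<^sub>H x \<Longrightarrow> norm \<phi> \<le> B"
    using bounded_map_sum_map[OF assms(7,10), of j] by (auto simp: bounded_map_def bounded_iff)
  interpret coercive_inclusion ?b ?\<alpha> G xt w R "B + norm yb" M
  proof
    show "R > 0"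
      by fact
    show "?b w w \<le> R\<^sup>2"
      using assms(16) unfolding norm_w W_norm_def by (rule sqrt_le_D)
    show "M = {x. ?b (x - xt) (x - xt) \<le> R\<^sup>2}"
      unfolding assms(5) W_cball_def W_norm_def
      using \<open>R > 0\<close> by (auto intro: sqrt_le_D real_le_lsqrt)
    show "norm \<phi> \<le> B + norm yb" if "x \<in> M" "\<phi> \<in> G x" for x \<phi>
    proof -
      obtain \<psi> where "\<psi> \<in> sum_map j F\<^sub>V F\<^sub>H x" "\<phi> = \<psi> - yb"
        using \<open>\<phi> \<in> G x\<close> by (auto simp: G_def)
      then show ?thesis
        using B[OF \<open>x \<in> M\<close>, of \<psi>] norm_triangle_ineq4[of \<psi> yb] by simp
    qed
    show "\<forall>\<^sub>F k in sequentially. strictly_below (G (xs k)) v c"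
      if "\<And>k. xs k \<in> M" "x \<in> M" "weakly_tendsto xs x" "strictly_below (G x) v c" for xs x v c
      unfolding G_def
      using ne[OF that(2)] assms(8,11) that[unfolded G_def] by (rule sum_map_strictly_below_eventually)
    show "\<exists>\<phi>\<in>G x. \<phi> (x - xt) \<le> - ?b (x - xt + w) (x - xt)" if "x \<in> M" for x
    proof -
      obtain y\<^sub>V y\<^sub>H where y: "y\<^sub>V \<in> F\<^sub>V x" "y\<^sub>H \<in> F\<^sub>H x"
        "(y\<^sub>V - yt\<^sub>V) (x - xt) \<le> l\<^sub>V * (norm (x - xt))\<^sup>2"
        "(y\<^sub>H - yt\<^sub>H) \<bullet> j (x - xt) \<le> l\<^sub>H * (norm (j (x - xt)))\<^sup>2"
        using assms(17) \<open>x \<in> M\<close> by blast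
      let ?\<phi> = "y\<^sub>V + dual_embed j y\<^sub>H - yb"
      have "?\<phi> (x - xt) = (y\<^sub>V - yt\<^sub>V) (x - xt) + (y\<^sub>H - yt\<^sub>H) \<bullet> j (x - xt) - (yb - yt) (x - xt)"
        unfolding assms(15) by (simp add: blinfun.add_left blinfun.diff_left inner_diff_left)
      also have "\<dots> \<le> - ?b (x - xt) (x - xt) - ?b w (x - xt)"
        using y(3,4) unfolding w by (simp add: W_inner_def flip: power2_norm_eq_inner)
      finally have "?\<phi> (x - xt) \<le> - ?b (x - xt + w) (x - xt)"
        unfolding b.add_left by simp
      moreover have "?\<phi> \<in> G x"
        using y(1,2) by (auto simp: G_def sum_map_def)
      ultimately show ?thesis
        by blast
    qed
  qed
  obtain e :: "nat \<Rightarrow> 'v" where "closure (range e) = UNIV"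
    using assms(1) separable_obtains_dense_sequence unfolding gelfand_triple_def by blast
  then obtain d where d: "?b (d + w) d \<le> 0" "\<And>v. \<not> strictly_below (G (xt + d)) v 0"
    by (rule exists_weak_zero) blast
  have "xt + d \<in> M"
    using small_ball_subset[OF d(1)] by (simp add: M_def)
  have "yb \<in> F (xt + d)"
  proof (rule ccontr)
    assume "yb \<notin> F (xt + d)"
    then have "yb \<noteq> y\<^sub>V + dual_embed j y\<^sub>H" if "y\<^sub>V \<in> F\<^sub>V (xt + d)" "y\<^sub>H \<in> F\<^sub>H (xt + d)" for y\<^sub>V y\<^sub>H
      using assms(12) \<open>xt + d \<in> M\<close> that by (auto simp: sum_map_def)
    then obtain v \<delta> where "\<delta> > 0" "\<And>y\<^sub>V y\<^sub>H. y\<^sub>V \<in> F\<^sub>V (xt + d) \<Longrightarrow> y\<^sub>H \<in> F\<^sub>H (xt + d) \<Longrightarrow>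
        (y\<^sub>V + dual_embed j y\<^sub>H - yb) v \<le> - \<delta>"
      using separate_from_sum[of "F\<^sub>V (xt + d)" "F\<^sub>H (xt + d)" yb j] assms(6,9) \<open>xt + d \<in> M\<close> by metis
    then have "strictly_below (G (xt + d)) v 0"
      unfolding strictly_below_def by (intro exI[of _ "- \<delta>"]) (auto simp: G_def sum_map_def)
    then show False
      using d(2) by blast
  qed
  moreover have "xt + d \<in> W_cball j l\<^sub>V l\<^sub>H x\<^sub>c (1 / 2 * W_dual_norm j l\<^sub>V l\<^sub>H (yt - yb))"
  proof -
    have eq: "xt + d - x\<^sub>c = d + (1/2) *\<^sub>R w"
      unfolding assms(18) w_def by simp
    have "?b (d + (1/2) *\<^sub>R w) (d + (1/2) *\<^sub>R w) = ?b (d + w) d + ?b w w / 4"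
      by (simp add: b.add_left b.add_right b.scaleR_left b.scaleR_right b.sym[of w d] field_simps)
    also have "\<dots> \<le> (1 / 2 * sqrt (?b w w))\<^sup>2"
      using d(1) b.nonneg[of w] by (simp add: power_mult_distrib power_divide)
    finally show ?thesis
      unfolding W_cball_def W_norm_def norm_w' mem_Collect_eq eq
      by (intro real_le_lsqrt) (auto simp: b.nonneg)
  qed
  ultimately show ?thesis
    by blast
qed

end
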